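(* Let $\alpha\vDash n$. The $H_n(0)$-module $\mathbf{S}_\alpha$ is indecomposable if and only if $\alpha$ is a simple composition of $n$.
   Context: A composition $\alpha=(\alpha_1,\ldots,\alpha_{\ell(\alpha)})$ of $n$ ($\alpha\vDash n$) is an ordered list of positive integers summing to $n$. It is called simple if: whenever $\alpha_i\geq\alpha_j\geq2$ and $1\leq i<j\leq\ell(\alpha)$, there exists an integer $k$ with $i<k<j$ such that $\alpha_k=\alpha_j-1$. The reverse composition diagram of $\alpha$ is the array of left-justified cells with $\alpha_i$ cells in row $i$ from the top; $(i,j)$ is the cell in row $i$, column $j$. A standard reverse composition tableau (SRCT) of shape $\alpha\vDash n$ is a bijective filling $\tau:\alpha\to\{1,\ldots,n\}$ such that (1) rows decrease from left to right; (2) the first column increases from top to bottom; (3) (triple rule) if $i<j$ and $\tau(i,k)>\tau(j,k+1)$, then $\tau(i,k+1)$ exists and $\tau(i,k+1)>\tau(j,k+1)$. $\mathrm{SRCT}(\alpha)$ is the set of SRCTs of shape $\alpha$. $\mathrm{Des}(\tau)=\{i\in[n-1]: i+1\text{ appears weakly right of } i\}$. Entries $i,i+1$ are attacking in $\tau$ if they are in the same column, or in adjacent columns with $i+1$ strictly southeast of $i$. For $1\leq i\leq n-1$, $\pi_i(\tau)=\tau$ if $i\notin\mathrm{Des}(\tau)$; $\pi_i(\tau)=0$ if $i\in\mathrm{Des}(\tau)$ and $i,i+1$ are attacking; and $\pi_i(\tau)=s_i(\tau)$, the SRCT obtained by interchanging the positions of $i$ and $i+1$, if $i\in\mathrm{Des}(\tau)$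 and $i,i+1$ are non-attacking. The $\pi_i$ satisfy the relations of the $0$-Hecke algebra $H_n(0)$, the $\mathbb{C}$-algebra generated by $T_1,\ldots,T_{n-1}$ with $T_i^2=T_i$, $T_iT_{i+1}T_i=T_{i+1}T_iT_{i+1}$, $T_iT_j=T_jT_i$ for $|i-j|\geq2$. $\mathbf{S}_\alpha$ is the $H_n(0)$-module with underlying space the $\mathbb{C}$-span of $\mathrm{SRCT}(\alpha)$ and $T_i$ acting as $\pi_i$ (extended linearly). *)

theory Defs
  imports Complex_Main "HOL-Algebra.QuotRing" "HOL-Algebra.Module"
    "HOL-Library.FuncSet" "HOL-Combinatorics.Transposition"
begin

section \<open>Compositions and standard reverse composition tableaux\<close>

text \<open>Rows, columns and parts are indexed from 0; all the conditions below are invariant under this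
  shift. Tableau entries are \<open>1, \<dots>, n\<close>.\<close>

definition composition_of :: "nat list \<Rightarrow> nat \<Rightarrow> bool" where
  "composition_of \<alpha> n \<longleftrightarrow> (\<forall>a\<in>set \<alpha>. 0 < a) \<and> sum_list \<alpha> = n"

definition simple_composition :: "nat list \<Rightarrow> bool" where
  "simple_composition \<alpha> \<longleftrightarrow>
     (\<forall>i j. i < j \<and> j < length \<alpha> \<and> \<alpha> ! i \<ge> \<alpha> ! j \<and> \<alpha> ! j \<ge> 2 \<longrightarrow>
        (\<exists>k. i < k \<and> k < j \<and> \<alpha> ! k = \<alpha> ! j - 1))"

type_synonym tableau = "nat \<times> nat \<Rightarrow> nat"

definition diagram :: "nat list \<Rightarrow> (nat \<times> nat) set" where
  "diagram \<alpha> = {(i, j). i < length \<alpha> \<and> j < \<alpha> ! i}"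

text \<open>Fillings are extensional, so that a filling is determined by its entries on the diagram.\<close>

definition SRCT :: "nat list \<Rightarrow> tableau set" where
  "SRCT \<alpha> = {\<tau> \<in> extensional (diagram \<alpha>).
     bij_betw \<tau> (diagram \<alpha>) {1..sum_list \<alpha>} \<and>
     (\<forall>i j k. j < k \<and> (i, j) \<in> diagram \<alpha> \<and> (i, k) \<in> diagram \<alpha> \<longrightarrow> \<tau> (i, j) > \<tau> (i, k)) \<and>
     (\<forall>i j. i < j \<and> (i, 0) \<in> diagram \<alpha> \<and> (j, 0) \<in> diagram \<alpha> \<longrightarrow> \<tau> (i, 0) < \<tau> (j, 0)) \<and>
     (\<forall>i j k. i < j \<and> (i, k) \<in> diagram \<alpha> \<and> (j, k + 1) \<in> diagram \<alpha> \<and> \<tau> (i, k) > \<tau> (j, k + 1) \<longrightarrow>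
        (i, k + 1) \<in> diagram \<alpha> \<and> \<tau> (i, k + 1) > \<tau> (j, k + 1))}"

definition cell_of :: "nat list \<Rightarrow> tableau \<Rightarrow> nat \<Rightarrow> nat \<times> nat" where
  "cell_of \<alpha> \<tau> = the_inv_into (diagram \<alpha>) \<tau>"

definition row_of :: "nat list \<Rightarrow> tableau \<Rightarrow> nat \<Rightarrow> nat" where
  "row_of \<alpha> \<tau> x = fst (cell_of \<alpha> \<tau> x)"

definition col_of :: "nat list \<Rightarrow> tableau \<Rightarrow> nat \<Rightarrow> nat" where
  "col_of \<alpha> \<tau> x = snd (cell_of \<alpha> \<tau> x)"

definition Des :: "nat list \<Rightarrow> tableau \<Rightarrow> nat set" where
  "Des \<alpha> \<tau> = {i \<in> {1..<sum_list \<alpha>}. col_of \<alpha> \<tau> i \<le> col_of \<alpha> \<tau> (i + 1)}"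

text \<open>Adjacent columns with \<open>i + 1\<close> strictly southeast of \<open>i\<close>: the entry \<open>i + 1\<close> is in the next
  column to the right and in a strictly lower row (larger row index).\<close>

definition attacking :: "nat list \<Rightarrow> tableau \<Rightarrow> nat \<Rightarrow> bool" where
  "attacking \<alpha> \<tau> i \<longleftrightarrow>
     col_of \<alpha> \<tau> (i + 1) = col_of \<alpha> \<tau> i \<or>
     col_of \<alpha> \<tau> (i + 1) = col_of \<alpha> \<tau> i + 1 \<and> row_of \<alpha> \<tau> i < row_of \<alpha> \<tau> (i + 1)"

definition swap_entries :: "nat list \<Rightarrow> nat \<Rightarrow> tableau \<Rightarrow> tableau" where
  "swap_entries \<alpha> i \<tau> = restrict (\<lambda>c. transpose i (i + 1) (\<tau> c)) (diagram \<alpha>)"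

text \<open>\<open>None\<close> stands for the zero vector.\<close>

definition pi_op :: "nat list \<Rightarrow> nat \<Rightarrow> tableau \<Rightarrow> tableau option" where
  "pi_op \<alpha> i \<tau> =
     (if i \<notin> Des \<alpha> \<tau> then Some \<tau>
      else if attacking \<alpha> \<tau> i then None
      else Some (swap_entries \<alpha> i \<tau>))"


section \<open>The 0-Hecke algebra\<close>

text \<open>The free unital associative \<open>\<complex>\<close>-algebra on the letters \<open>1, \<dots>, n - 1\<close>: finitely supported
  complex functions on words, with convolution along concatenation of words.\<close>

definition free_algebra :: "nat \<Rightarrow> (nat list \<Rightarrow> complex) ring" where
  "free_algebra n =
     \<lparr>carrier = {f. finite {w. f w \<noteq> 0} \<and> (\<forall>w. f w \<noteq> 0 \<longrightarrow> set w \<subseteq> {1..<n})},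
      mult = (\<lambda>f g w. \<Sum>k\<le>length w. f (take k w) * g (drop k w)),
      one = (\<lambda>w. if w = [] then 1 else 0),
      zero = (\<lambda>w. 0),
      add = (\<lambda>f g w. f w + g w)\<rparr>"

definition word_diff :: "nat list \<Rightarrow> nat list \<Rightarrow> nat list \<Rightarrow> complex" where
  "word_diff u v = (\<lambda>w. (if w = u then 1 else 0) - (if w = v then 1 else 0))"

definition hecke0_relators :: "nat \<Rightarrow> (nat list \<Rightarrow> complex) set" where
  "hecke0_relators n =
     {word_diff [i, i] [i] | i. i \<in> {1..<n}} \<union>
     {word_diff [i, i + 1, i] [i + 1, i, i + 1] | i. i \<in> {1..<n} \<and> i + 1 \<in> {1..<n}} \<union>
     {word_diff [i, j] [j, i] | i j. i \<in> {1..<n} \<and> j \<in> {1..<n} \<and> \<bar>int i - int j\<bar> \<ge> 2}"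

text \<open>The scalars \<open>\<complex>\<close> sit inside this ring as the multiples of its unit, so its modules and
  submodules are automatically complex vector spaces and subspaces.\<close>

definition hecke0 :: "nat \<Rightarrow> (nat list \<Rightarrow> complex) set ring" where
  "hecke0 n = free_algebra n Quot (Idl\<^bsub>free_algebra n\<^esub> (hecke0_relators n))"


section \<open>The module of standard reverse composition tableaux\<close>

definition pi_linear ::
    "nat list \<Rightarrow> nat \<Rightarrow> (tableau \<Rightarrow> complex) \<Rightarrow> tableau \<Rightarrow> complex" where
  "pi_linear \<alpha> i v = (\<lambda>\<sigma>. \<Sum>\<tau>\<in>SRCT \<alpha>. if pi_op \<alpha> i \<tau> = Some \<sigma> then v \<tau> else 0)"

text \<open>The word \<open>[i\<^sub>1, \<dots>, i\<^sub>k]\<close> acts as the composite of the operators for \<open>i\<^sub>1, \<dots>, i\<^sub>k\<close>, the last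
  one being applied first.\<close>

definition free_action ::
    "nat list \<Rightarrow> (nat list \<Rightarrow> complex) \<Rightarrow> (tableau \<Rightarrow> complex) \<Rightarrow> tableau \<Rightarrow> complex" where
  "free_action \<alpha> f v = (\<lambda>\<sigma>. \<Sum>w | f w \<noteq> 0. f w * foldr (pi_linear \<alpha>) w v \<sigma>)"

text \<open>A vector of the \<open>\<complex>\<close>-span of \<open>SRCT \<alpha>\<close> is its coefficient function. An element of the 0-Hecke
  algebra is a coset \<open>X\<close> of the relation ideal; it acts by the common action of its representatives
  (they agree because the operators satisfy the 0-Hecke relations). The ring multiplication and unit
  that the library's module record carries along play no role.\<close>

definition SRCT_module :: "nat list \<Rightarrow> ((nat list \<Rightarrow> complex) set, tableau \<Rightarrow> complex) module" where
  "SRCT_module \<alpha> =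
     \<lparr>carrier = {v. \<forall>\<tau>. \<tau> \<notin> SRCT \<alpha> \<longrightarrow> v \<tau> = 0},
      mult = undefined,
      one = undefined,
      zero = (\<lambda>\<tau>. 0),
      add = (\<lambda>u v \<tau>. u \<tau> + v \<tau>),
      smult = (\<lambda>X v. the_elem ((\<lambda>f. free_action \<alpha> f v) ` X))\<rparr>"


section \<open>Indecomposability\<close>

text \<open>The locale \<^locale>\<open>submodule\<close> does not assume the ring to be commutative, unlike
  \<^locale>\<open>module\<close>, so it is the usual notion of submodule of a left module.\<close>

definition indecomposable_module :: "('r, 's) ring_scheme \<Rightarrow> ('r, 'v, 't) module_scheme \<Rightarrow> bool" where
  "indecomposable_module R M \<longleftrightarrow>
     carrier M \<noteq> {\<zero>\<^bsub>M\<^esub>} \<and>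
     \<not> (\<exists>A B. submodule A R M \<and> submodule B R M \<and>
            A \<noteq> {\<zero>\<^bsub>M\<^esub>} \<and> B \<noteq> {\<zero>\<^bsub>M\<^esub>} \<and>
            A \<inter> B = {\<zero>\<^bsub>M\<^esub>} \<and> A <+>\<^bsub>M\<^esub> B = carrier M)"

end

theory Submission
  imports Defs
begin

text \<open>
  The operators never interchange two entries of the same column, so the order pattern of the columns
  is an invariant and splits the module. One pattern, all columns increasing downwards, is always
  realised by the tableau filled row by row; every tableau has this pattern iff \<open>\<alpha>\<close> is simple.

  If it is the only pattern, the row-by-row tableau \<open>\<tau>\<^sub>0\<close> generates the module, because a tableau that
  cannot be lifted by undoing an operator must be \<open>\<tau>\<^sub>0\<close>. Given a decomposition \<open>A \<oplus> B\<close>, the component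
  of \<open>\<tau>\<^sub>0\<close> in \<open>A\<close> is fixed by every operator fixing \<open>\<tau>\<^sub>0\<close>, hence is supported on tableaux whose
  descent set lies in that of \<open>\<tau>\<^sub>0\<close>. Only \<open>\<tau>\<^sub>0\<close> itself qualifies, so \<open>\<tau>\<^sub>0\<close> lies in \<open>A\<close> or in \<open>B\<close>.
\<close>

section \<open>The free algebra and its action\<close>

text \<open>An element of the algebra is a coset in a quotient of a free algebra and acts through
  \<open>the_elem\<close>. The 0-Hecke relations must therefore be verified for the operators before
  anything can be said about the module. Afterwards a submodule is a complex subspace stable under
  each \<open>pi_linear \<alpha> i\<close>, and cosets disappear from the argument.

  For the splitting, all patterns other than the increasing one are collected in a single second
  summand, so that of these only the existence of one tableau has to be shown.

  If an operator fixes the sum, then the change it makes to a is the negative of the change it makes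
  to b; this vector lies in \<open>A\<close> and in \<open>B\<close>, hence is zero. Descent sets
  enter because the operators are idempotent: outputs are fixed, whereas a tableau with descent
  \<open>i\<close> is killed or moved by the operator of index \<open>i\<close>, so no output has a
  coefficient there.\<close>

abbreviation supp :: "('a \<Rightarrow> complex) \<Rightarrow> 'a set" where
  "supp f \<equiv> {w. f w \<noteq> 0}"

definition convolution :: "('a list \<Rightarrow> complex) \<Rightarrow> ('a list \<Rightarrow> complex) \<Rightarrow> 'a list \<Rightarrow> complex" where
  "convolution f g = (\<lambda>w. \<Sum>k\<le>length w. f (take k w) * g (drop k w))"

lemma supp_convolution:
  "supp (convolution f g) \<subseteq> (\<lambda>(u, v). u @ v) ` (supp f \<times> supp g)"
proof
  fix w assume "w \<in> supp (convolution f g)"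
  then obtain k where "f (take k w) * g (drop k w) \<noteq> 0"
    unfolding convolution_def by (auto elim: sum.not_neutral_contains_not_neutral)
  then have "(take k w, drop k w) \<in> supp f \<times> supp g" by auto
  then show "w \<in> (\<lambda>(u, v). u @ v) ` (supp f \<times> supp g)"
    by (force intro: image_eqI[where x = "(take k w, drop k w)"])
qed

lemma finite_supp_convolution:
  "finite (supp f) \<Longrightarrow> finite (supp g) \<Longrightarrow> finite (supp (convolution f g))"
  by (rule finite_subset[OF supp_convolution]) auto

lemma sum_supp_superset:
  fixes f :: "'a \<Rightarrow> complex"
  assumes "finite S" "supp f \<subseteq> S"
  shows "(\<Sum>w\<in>supp f. f w * X w) = (\<Sum>w\<in>S. f w * X w)"
  by (rule sum.mono_neutral_left) (use assms in auto)

text \<open>Convolution is the image of a product of two weights under concatenation, so the linear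
  extension of any function \<open>X\<close> on words can be evaluated on pairs of words. With an
  indicator for \<open>X\<close> this yields associativity; with the composite operators of words it
  yields compatibility of the action with products.\<close>

lemma sum_convolution:
  assumes "finite (supp f)" "finite (supp g)"
  shows "(\<Sum>w\<in>supp (convolution f g). convolution f g w * X w)
    = (\<Sum>u\<in>supp f. \<Sum>v\<in>supp g. f u * g v * X (u @ v))"
proof -
  obtain W where W: "W = (\<lambda>(u, v). u @ v) ` (supp f \<times> supp g)" by blast
  have fin: "finite W" using assms by (auto simp: W)
  have sub: "supp (convolution f g) \<subseteq> W" using supp_convolution[of f g] by (simp add: W)
  have mem: "u @ v \<in> W" if "f u \<noteq> 0" "g v \<noteq> 0" for u v using that by (auto simp: W)
  have "(\<Sum>w\<in>supp (convolution f g). convolution f g w * X w) = (\<Sum>w\<in>W. convolution f g w * X w)"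
    by (rule sum_supp_superset[OF fin sub])
  also have "\<dots> = (\<Sum>w\<in>W. \<Sum>k\<in>{..length w}. f (take k w) * g (drop k w) * X w)"
    by (simp add: convolution_def sum_distrib_right)
  also have "\<dots> = (\<Sum>(w, k)\<in>Sigma W (\<lambda>w. {..length w}). f (take k w) * g (drop k w) * X w)"
    by (rule sum.Sigma) (use fin in auto)
  \<comment> \<open>A word with a cut position is the same thing as a pair of words. Cuts with
    vanishing product have no partner among pairs from the supports and are set aside in
    \<open>S'\<close>.\<close>
  also have "\<dots> = (\<Sum>(u, v)\<in>supp f \<times> supp g. f u * g v * X (u @ v))"
    by (rule sum.reindex_bij_witness_not_neutral[where
          T' = "{}" and
          S' = "{(w, k) \<in> Sigma W (\<lambda>w. {..length w}). f (take k w) * g (drop k w) = 0}" and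
          i = "\<lambda>(u, v). (u @ v, length u)" and
          j = "\<lambda>(w, k). (take k w, drop k w)"])
      (use mem in \<open>auto intro: finite_subset[OF _ finite_SigmaI[OF fin, of "\<lambda>w. {..length w}"]]\<close>)
  also have "\<dots> = (\<Sum>u\<in>supp f. \<Sum>v\<in>supp g. f u * g v * X (u @ v))"
    by (rule sum.Sigma[symmetric]) (use assms in auto)
  finally show ?thesis .
qed

lemma convolution_eq_sum:
  assumes "finite (supp f)" "finite (supp g)"
  shows "convolution f g w = (\<Sum>u\<in>supp f. \<Sum>v\<in>supp g. f u * g v * (if u @ v = w then 1 else 0))"
proof -
  have "convolution f g w = (\<Sum>z\<in>supp (convolution f g). convolution f g z * (if z = w then 1 else 0))"
    using finite_supp_convolution[OF assms] by (auto simp: sum.delta if_distrib cong: if_cong)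
  then show ?thesis by (simp only: sum_convolution[OF assms])
qed

text \<open>Both bracketings become triple sums over the three supports, where only the
  associativity of \<open>@\<close> is left; cut positions never have to be reindexed.\<close>

lemma convolution_assoc:
  assumes "finite (supp f)" "finite (supp g)" "finite (supp h)"
  shows "convolution (convolution f g) h = convolution f (convolution g h)"
proof
  fix w :: "'a list"
  let ?d = "\<lambda>z. if z = w then 1 else (0::complex)"
  have "convolution (convolution f g) h w
      = (\<Sum>x\<in>supp (convolution f g). convolution f g x * (\<Sum>t\<in>supp h. h t * ?d (x @ t)))"
    by (simp only: convolution_eq_sum[OF finite_supp_convolution[OF assms(1,2)] assms(3)]
        sum_distrib_left mult.assoc)
  also have "\<dots> = (\<Sum>u\<in>supp f. \<Sum>v\<in>supp g. f u * g v * (\<Sum>t\<in>supp h. h t * ?d ((u @ v) @ t)))"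
    by (rule sum_convolution[OF assms(1,2)])
  also have "\<dots> = (\<Sum>u\<in>supp f. f u * (\<Sum>v\<in>supp g. \<Sum>t\<in>supp h. g v * h t * ?d (u @ v @ t)))"
    by (simp only: sum_distrib_left mult.assoc append_assoc)
  also have "\<dots> = (\<Sum>u\<in>supp f. f u * (\<Sum>x\<in>supp (convolution g h). convolution g h x * ?d (u @ x)))"
    by (simp only: sum_convolution[OF assms(2,3), of "\<lambda>x. ?d (u @ x)" for u])
  also have "\<dots> = convolution f (convolution g h) w"
    by (simp only: convolution_eq_sum[OF assms(1) finite_supp_convolution[OF assms(2,3)]]
        sum_distrib_left mult.assoc)
  finally show "convolution (convolution f g) h w = convolution f (convolution g h) w" .
qed

lemma finite_supp_add:
  fixes f g :: "'a \<Rightarrow> complex"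
  assumes "finite (supp f)" "finite (supp g)"
  shows "finite (supp (\<lambda>w. f w + g w))"
  by (rule finite_subset[of _ "supp f \<union> supp g"]) (use assms in auto)

lemma convolution_add_left: "convolution (\<lambda>w. f w + g w) h = (\<lambda>w. convolution f h w + convolution g h w)"
  by (simp add: convolution_def distrib_right sum.distrib)

lemma convolution_add_right: "convolution h (\<lambda>w. f w + g w) = (\<lambda>w. convolution h f w + convolution h g w)"
  by (simp add: convolution_def distrib_left sum.distrib)

lemma convolution_one_left: "convolution (\<lambda>w. if w = [] then 1 else 0) f = f"
proof
  fix w
  have "convolution (\<lambda>w. if w = [] then 1 else 0) f w = (\<Sum>k\<le>length w. if k = 0 then f w else 0)"
    unfolding convolution_def by (rule sum.cong) auto
  then show "convolution (\<lambda>w. if w = [] then 1 else 0) f w = f w" by simp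
qed

lemma convolution_one_right: "convolution f (\<lambda>w. if w = [] then 1 else 0) = f"
proof
  fix w
  have "convolution f (\<lambda>w. if w = [] then 1 else 0) w = (\<Sum>k\<le>length w. if k = length w then f w else 0)"
    unfolding convolution_def by (rule sum.cong) auto
  then show "convolution f (\<lambda>w. if w = [] then 1 else 0) w = f w" by simp
qed

lemma free_algebra_simps:
  "carrier (free_algebra n) = {f. finite (supp f) \<and> (\<forall>w. f w \<noteq> 0 \<longrightarrow> set w \<subseteq> {1..<n})}"
  "f \<otimes>\<^bsub>free_algebra n\<^esub> g = convolution f g"
  "\<one>\<^bsub>free_algebra n\<^esub> = (\<lambda>w. if w = [] then 1 else 0)"
  "\<zero>\<^bsub>free_algebra n\<^esub> = (\<lambda>w. 0)"
  "f \<oplus>\<^bsub>free_algebra n\<^esub> g = (\<lambda>w. f w + g w)"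
  by (simp_all add: free_algebra_def convolution_def)

lemma ring_free_algebra: "ring (free_algebra n)"
proof (rule ringI)
  show "abelian_group (free_algebra n)"
  proof (rule abelian_groupI; (unfold free_algebra_simps)?)
    fix f g :: "nat list \<Rightarrow> complex"
    assume f: "f \<in> {f. finite (supp f) \<and> (\<forall>w. f w \<noteq> 0 \<longrightarrow> set w \<subseteq> {1..<n})}"
      and g: "g \<in> {f. finite (supp f) \<and> (\<forall>w. f w \<noteq> 0 \<longrightarrow> set w \<subseteq> {1..<n})}"
    show "(\<lambda>w. f w + g w) \<in> {f. finite (supp f) \<and> (\<forall>w. f w \<noteq> 0 \<longrightarrow> set w \<subseteq> {1..<n})}"
    proof (intro CollectI conjI allI impI)
      show "finite (supp (\<lambda>w. f w + g w))" using f g by (intro finite_supp_add) auto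
      fix w assume "f w + g w \<noteq> 0"
      then show "set w \<subseteq> {1..<n}" using f g by (cases "f w = 0") auto
    qed
  next
    fix f :: "nat list \<Rightarrow> complex"
    assume f: "f \<in> {f. finite (supp f) \<and> (\<forall>w. f w \<noteq> 0 \<longrightarrow> set w \<subseteq> {1..<n})}"
    show "\<exists>g\<in>{f. finite (supp f) \<and> (\<forall>w. f w \<noteq> 0 \<longrightarrow> set w \<subseteq> {1..<n})}. (\<lambda>w. g w + f w) = (\<lambda>w. 0)"
      using f by (intro bexI[where x = "\<lambda>w. - f w"]) auto
  qed (auto simp: algebra_simps)
  have closed: "convolution f g \<in> carrier (free_algebra n)"
    if fg: "f \<in> carrier (free_algebra n)" "g \<in> carrier (free_algebra n)" for f g
    unfolding free_algebra_simps
  proof (intro CollectI conjI allI impI)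
    show "finite (supp (convolution f g))"
      using fg by (intro finite_supp_convolution) (auto simp: free_algebra_simps)
    fix w assume "convolution f g w \<noteq> 0"
    then obtain u v where "w = u @ v" "f u \<noteq> 0" "g v \<noteq> 0"
      using supp_convolution[of f g] by auto
    then show "set w \<subseteq> {1..<n}" using fg unfolding free_algebra_simps by auto
  qed
  show "monoid (free_algebra n)"
  proof (rule monoidI; (unfold free_algebra_simps(2))?)
    fix f g h :: "nat list \<Rightarrow> complex"
    assume "f \<in> carrier (free_algebra n)" "g \<in> carrier (free_algebra n)" "h \<in> carrier (free_algebra n)"
    then show "convolution (convolution f g) h = convolution f (convolution g h)"
      by (intro convolution_assoc) (auto simp: free_algebra_simps)
  qed (simp_all only: closed free_algebra_simps(3) convolution_one_left convolution_one_right,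
       auto simp: free_algebra_simps)
qed (auto simp: free_algebra_simps convolution_add_left convolution_add_right)

section \<open>Linear extensions of partial maps\<close>

lemma sum_restrict_supp:
  assumes "finite S" "\<And>\<tau>. \<tau> \<notin> S \<Longrightarrow> v \<tau> = (0::complex)"
  shows "v \<sigma> = (\<Sum>\<tau>\<in>S. if \<tau> = \<sigma> then v \<tau> else 0)"
  using assms by (cases "\<sigma> \<in> S") (auto simp: sum.delta)

lemma finite_SRCT: "finite (SRCT \<alpha>)"
proof -
  have "finite (Sigma {..<length \<alpha>} (\<lambda>i. {..<\<alpha> ! i}))" by auto
  moreover have "diagram \<alpha> = Sigma {..<length \<alpha>} (\<lambda>i. {..<\<alpha> ! i})" by (auto simp: diagram_def)
  ultimately have "finite (diagram \<alpha>)" by simp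
  then have "finite (PiE (diagram \<alpha>) (\<lambda>_. {1..sum_list \<alpha>}))" by (intro finite_PiE) auto
  then show ?thesis
    by (rule rev_finite_subset) (auto simp: SRCT_def PiE_def bij_betw_def)
qed

definition push :: "nat list \<Rightarrow> (tableau \<Rightarrow> tableau option) \<Rightarrow> (tableau \<Rightarrow> complex) \<Rightarrow> tableau \<Rightarrow> complex" where
  "push \<alpha> g v = (\<lambda>\<sigma>. \<Sum>\<tau>\<in>SRCT \<alpha>. if g \<tau> = Some \<sigma> then v \<tau> else 0)"

definition spanned :: "tableau set \<Rightarrow> (tableau \<Rightarrow> complex) set" where
  "spanned S = {v. \<forall>\<tau>. \<tau> \<notin> S \<longrightarrow> v \<tau> = 0}"

lemma push_cong: "(\<And>\<tau>. \<tau> \<in> SRCT \<alpha> \<Longrightarrow> g \<tau> = h \<tau>) \<Longrightarrow> push \<alpha> g v = push \<alpha> h v"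
  by (auto simp: push_def intro!: sum.cong ext)

text \<open>The assumption keeps the intermediate tableaux inside the range of the outer sum; a
  value outside \<open>SRCT \<alpha>\<close> would be lost there.\<close>

lemma push_push:
  assumes "\<And>\<tau> \<sigma>. \<tau> \<in> SRCT \<alpha> \<Longrightarrow> g \<tau> = Some \<sigma> \<Longrightarrow> \<sigma> \<in> SRCT \<alpha>"
  shows "push \<alpha> h (push \<alpha> g v) = push \<alpha> (\<lambda>\<tau>. Option.bind (g \<tau>) h) v"
proof
  fix \<rho>
  have "push \<alpha> h (push \<alpha> g v) \<rho>
      = (\<Sum>\<sigma>\<in>SRCT \<alpha>. \<Sum>\<tau>\<in>SRCT \<alpha>. if h \<sigma> = Some \<rho> \<and> g \<tau> = Some \<sigma> then v \<tau> else 0)"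
    unfolding push_def by (auto intro!: sum.cong)
  also have "\<dots> = (\<Sum>\<tau>\<in>SRCT \<alpha>. \<Sum>\<sigma>\<in>SRCT \<alpha>. if h \<sigma> = Some \<rho> \<and> g \<tau> = Some \<sigma> then v \<tau> else 0)"
    by (rule sum.swap)
  also have "\<dots> = (\<Sum>\<tau>\<in>SRCT \<alpha>. if Option.bind (g \<tau>) h = Some \<rho> then v \<tau> else 0)"
  proof (rule sum.cong[OF refl])
    fix \<tau> assume \<tau>: "\<tau> \<in> SRCT \<alpha>"
    show "(\<Sum>\<sigma>\<in>SRCT \<alpha>. if h \<sigma> = Some \<rho> \<and> g \<tau> = Some \<sigma> then v \<tau> else 0)
        = (if Option.bind (g \<tau>) h = Some \<rho> then v \<tau> else 0)"
    proof (cases "g \<tau>")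
      case (Some \<sigma>')
      have "(\<Sum>\<sigma>\<in>SRCT \<alpha>. if h \<sigma> = Some \<rho> \<and> g \<tau> = Some \<sigma> then v \<tau> else 0)
        = (\<Sum>\<sigma>\<in>SRCT \<alpha>. if \<sigma>' = \<sigma> then (if h \<sigma>' = Some \<rho> then v \<tau> else 0) else 0)"
        unfolding Some by (rule sum.cong[OF refl]) auto
      also have "\<dots> = (if h \<sigma>' = Some \<rho> then v \<tau> else 0)"
        using Some assms[OF \<tau>] finite_SRCT[of \<alpha>] by (subst sum.delta') auto
      finally show ?thesis by (simp only: Some option.inject bind.bind_lunit)
    qed simp
  qed
  finally show "push \<alpha> h (push \<alpha> g v) \<rho> = push \<alpha> (\<lambda>\<tau>. Option.bind (g \<tau>) h) v \<rho>"
    by (simp add: push_def)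
qed

lemma push_spanned:
  assumes "\<And>\<tau> \<sigma>. \<tau> \<in> SRCT \<alpha> \<Longrightarrow> \<tau> \<in> S \<Longrightarrow> g \<tau> = Some \<sigma> \<Longrightarrow> \<sigma> \<in> S" "v \<in> spanned S"
  shows "push \<alpha> g v \<in> spanned S"
  using assms unfolding push_def spanned_def by (auto intro!: sum.neutral) blast

lemma push_sum:
  assumes "finite W"
  shows "push \<alpha> g (\<lambda>\<sigma>. \<Sum>w\<in>W. c w * x w \<sigma>) = (\<lambda>\<sigma>. \<Sum>w\<in>W. c w * push \<alpha> g (x w) \<sigma>)"
proof
  fix \<sigma>
  have "push \<alpha> g (\<lambda>\<sigma>. \<Sum>w\<in>W. c w * x w \<sigma>) \<sigma> = (\<Sum>\<tau>\<in>SRCT \<alpha>. \<Sum>w\<in>W. c w * (if g \<tau> = Some \<sigma> then x w \<tau> else 0))"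
    unfolding push_def by (auto intro!: sum.cong)
  also have "\<dots> = (\<Sum>w\<in>W. \<Sum>\<tau>\<in>SRCT \<alpha>. c w * (if g \<tau> = Some \<sigma> then x w \<tau> else 0))" by (rule sum.swap)
  finally show "push \<alpha> g (\<lambda>\<sigma>. \<Sum>w\<in>W. c w * x w \<sigma>) \<sigma> = (\<Sum>w\<in>W. c w * push \<alpha> g (x w) \<sigma>)"
    by (simp add: push_def sum_distrib_left)
qed

lemma pi_linear_eq_push: "pi_linear \<alpha> i = push \<alpha> (pi_op \<alpha> i)"
  by (auto simp: pi_linear_def push_def)

lemma foldr_pi_linear_sum:
  assumes "finite W"
  shows "foldr (pi_linear \<alpha>) u (\<lambda>\<sigma>. \<Sum>w\<in>W. c w * x w \<sigma>) = (\<lambda>\<sigma>. \<Sum>w\<in>W. c w * foldr (pi_linear \<alpha>) u (x w) \<sigma>)"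
  by (induction u) (simp_all add: pi_linear_eq_push push_sum[OF assms])

text \<open>A word applies its last letter first, so \<open>foldr\<close> turns concatenation into
  composition in the same order: a left action.\<close>

lemma free_action_convolution:
  assumes "finite (supp f)" "finite (supp g)"
  shows "free_action \<alpha> (convolution f g) v = free_action \<alpha> f (free_action \<alpha> g v)"
  unfolding free_action_def
  by (simp add: sum_convolution[OF assms] foldr_pi_linear_sum[OF assms(2)] sum_distrib_left mult.assoc)

lemma free_action_add:
  assumes "finite (supp f)" "finite (supp g)"
  shows "free_action \<alpha> (\<lambda>w. f w + g w) v = (\<lambda>\<sigma>. free_action \<alpha> f v \<sigma> + free_action \<alpha> g v \<sigma>)"
proof
  fix \<sigma>
  let ?S = "supp f \<union> supp g"
  have S: "finite ?S" "supp f \<subseteq> ?S" "supp g \<subseteq> ?S" "supp (\<lambda>w. f w + g w) \<subseteq> ?S" using assms by auto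
  show "free_action \<alpha> (\<lambda>w. f w + g w) v \<sigma> = free_action \<alpha> f v \<sigma> + free_action \<alpha> g v \<sigma>"
    unfolding free_action_def sum_supp_superset[OF S(1,2)] sum_supp_superset[OF S(1,3)]
      sum_supp_superset[OF S(1,4)]
    by (simp add: distrib_right sum.distrib)
qed

lemma free_action_word_diff:
  assumes "u \<noteq> w"
  shows "free_action \<alpha> (word_diff u w) v = (\<lambda>\<sigma>. foldr (pi_linear \<alpha>) u v \<sigma> - foldr (pi_linear \<alpha>) w v \<sigma>)"
proof -
  have "supp (word_diff u w) = {u, w}" using assms by (auto simp: word_diff_def)
  then show ?thesis using assms by (auto simp: free_action_def word_diff_def)
qed

lemma free_action_uminus: "free_action \<alpha> (\<lambda>w. - f w) v = (\<lambda>\<sigma>. - free_action \<alpha> f v \<sigma>)"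
  by (simp add: free_action_def sum_negf)

lemma free_action_zero: "free_action \<alpha> f (\<lambda>_. 0) = (\<lambda>_. 0)"
proof -
  have "pi_linear \<alpha> i (\<lambda>_. 0) = (\<lambda>_. 0)" for i
    by (auto simp: pi_linear_def)
  then have "foldr (pi_linear \<alpha>) w (\<lambda>_. 0) = (\<lambda>_. 0)" for w
    by (induction w) simp_all
  then show ?thesis by (simp add: free_action_def)
qed

section \<open>The operators on tableaux\<close>

text \<open>Bijective fillings without the three order conditions. Swaps of entries always stay in
  this set, so the 0-Hecke relations can be checked on it from the positions of the entries
  alone.\<close>

definition fillings :: "nat list \<Rightarrow> tableau set" where
  "fillings \<alpha> = {\<tau> \<in> extensional (diagram \<alpha>). bij_betw \<tau> (diagram \<alpha>) {1..sum_list \<alpha>}}"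

lemma SRCT_fillings: "\<tau> \<in> SRCT \<alpha> \<Longrightarrow> \<tau> \<in> fillings \<alpha>"
  by (simp add: SRCT_def fillings_def)

lemma SRCT_iff:
  "\<tau> \<in> SRCT \<alpha> \<longleftrightarrow> \<tau> \<in> fillings \<alpha> \<and>
     (\<forall>i j k. j < k \<and> (i, j) \<in> diagram \<alpha> \<and> (i, k) \<in> diagram \<alpha> \<longrightarrow> \<tau> (i, j) > \<tau> (i, k)) \<and>
     (\<forall>i j. i < j \<and> (i, 0) \<in> diagram \<alpha> \<and> (j, 0) \<in> diagram \<alpha> \<longrightarrow> \<tau> (i, 0) < \<tau> (j, 0)) \<and>
     (\<forall>i j k. i < j \<and> (i, k) \<in> diagram \<alpha> \<and> (j, k + 1) \<in> diagram \<alpha> \<and> \<tau> (i, k) > \<tau> (j, k + 1) \<longrightarrow>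
        (i, k + 1) \<in> diagram \<alpha> \<and> \<tau> (i, k + 1) > \<tau> (j, k + 1))"
  by (auto simp: SRCT_def fillings_def)

lemma SRCT_row:
  "\<tau> \<in> SRCT \<alpha> \<Longrightarrow> j < k \<Longrightarrow> (i, j) \<in> diagram \<alpha> \<Longrightarrow> (i, k) \<in> diagram \<alpha> \<Longrightarrow> \<tau> (i, k) < \<tau> (i, j)"
  by (auto simp: SRCT_def)

lemma SRCT_first_column:
  "\<tau> \<in> SRCT \<alpha> \<Longrightarrow> i < j \<Longrightarrow> (i, 0) \<in> diagram \<alpha> \<Longrightarrow> (j, 0) \<in> diagram \<alpha> \<Longrightarrow> \<tau> (i, 0) < \<tau> (j, 0)"
  by (auto simp: SRCT_def)

lemma SRCT_triple:
  assumes "\<tau> \<in> SRCT \<alpha>" "i < j" "(i, k) \<in> diagram \<alpha>" "(j, Suc k) \<in> diagram \<alpha>"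
    "\<tau> (j, Suc k) < \<tau> (i, k)"
  shows "(i, Suc k) \<in> diagram \<alpha>" "\<tau> (j, Suc k) < \<tau> (i, Suc k)"
  using assms by (auto simp: SRCT_def)

lemma diagram_left: "(i, k) \<in> diagram \<alpha> \<Longrightarrow> j \<le> k \<Longrightarrow> (i, j) \<in> diagram \<alpha>"
  by (auto simp: diagram_def)

lemma fillings_eqI:
  "\<tau> \<in> fillings \<alpha> \<Longrightarrow> \<sigma> \<in> fillings \<alpha> \<Longrightarrow> (\<And>d. d \<in> diagram \<alpha> \<Longrightarrow> \<tau> d = \<sigma> d) \<Longrightarrow> \<tau> = \<sigma>"
  unfolding fillings_def by (auto intro: extensionalityI)

lemma entry_range: "\<tau> \<in> fillings \<alpha> \<Longrightarrow> d \<in> diagram \<alpha> \<Longrightarrow> \<tau> d \<in> {1..sum_list \<alpha>}"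
  unfolding fillings_def bij_betw_def by blast

lemma entry_inject:
  "\<tau> \<in> fillings \<alpha> \<Longrightarrow> d \<in> diagram \<alpha> \<Longrightarrow> e \<in> diagram \<alpha> \<Longrightarrow> \<tau> d = \<tau> e \<longleftrightarrow> d = e"
  by (auto simp: fillings_def bij_betw_def inj_on_eq_iff)

lemma cell_of_entry: "\<tau> \<in> fillings \<alpha> \<Longrightarrow> d \<in> diagram \<alpha> \<Longrightarrow> cell_of \<alpha> \<tau> (\<tau> d) = d"
  by (auto simp: fillings_def cell_of_def bij_betw_def the_inv_into_f_f)

lemma entry_cell_of: "\<tau> \<in> fillings \<alpha> \<Longrightarrow> x \<in> {1..sum_list \<alpha>} \<Longrightarrow> \<tau> (cell_of \<alpha> \<tau> x) = x"
  unfolding fillings_def cell_of_def bij_betw_def by (auto intro!: f_the_inv_into_f)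

lemma cell_of_diagram: "\<tau> \<in> fillings \<alpha> \<Longrightarrow> x \<in> {1..sum_list \<alpha>} \<Longrightarrow> cell_of \<alpha> \<tau> x \<in> diagram \<alpha>"
  unfolding fillings_def cell_of_def bij_betw_def by (auto intro!: the_inv_into_into)

lemma cell_of_eq_iff:
  "\<tau> \<in> fillings \<alpha> \<Longrightarrow> x \<in> {1..sum_list \<alpha>} \<Longrightarrow> d \<in> diagram \<alpha> \<Longrightarrow> cell_of \<alpha> \<tau> x = d \<longleftrightarrow> \<tau> d = x"
  using cell_of_entry entry_cell_of by metis

lemma swap_entries_apply:
  "d \<in> diagram \<alpha> \<Longrightarrow> swap_entries \<alpha> i \<tau> d = transpose i (Suc i) (\<tau> d)"
  by (simp add: swap_entries_def)

lemma swap_entries_fillings: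
  assumes "\<tau> \<in> fillings \<alpha>" "i \<in> {1..<sum_list \<alpha>}"
  shows "swap_entries \<alpha> i \<tau> \<in> fillings \<alpha>"
proof -
  have "bij_betw (transpose i (Suc i)) {1..sum_list \<alpha>} {1..sum_list \<alpha>}"
    using assms(2) by (auto simp: bij_betw_transpose_iff)
  then have "bij_betw (transpose i (Suc i) \<circ> \<tau>) (diagram \<alpha>) {1..sum_list \<alpha>}"
    using assms(1) by (auto simp: fillings_def intro: bij_betw_trans)
  then have "bij_betw (swap_entries \<alpha> i \<tau>) (diagram \<alpha>) {1..sum_list \<alpha>}"
    by (subst bij_betw_cong[where g = "transpose i (Suc i) \<circ> \<tau>"]) (auto simp: swap_entries_apply)
  then show ?thesis by (simp add: fillings_def swap_entries_def)
qed

lemma cell_of_swap_entries: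
  assumes "\<tau> \<in> fillings \<alpha>" "i \<in> {1..<sum_list \<alpha>}" "x \<in> {1..sum_list \<alpha>}"
  shows "cell_of \<alpha> (swap_entries \<alpha> i \<tau>) x = cell_of \<alpha> \<tau> (transpose i (Suc i) x)"
proof -
  have t: "transpose i (Suc i) x \<in> {1..sum_list \<alpha>}" using assms by (auto simp: transpose_def)
  have d: "cell_of \<alpha> \<tau> (transpose i (Suc i) x) \<in> diagram \<alpha>" by (rule cell_of_diagram[OF assms(1) t])
  have "swap_entries \<alpha> i \<tau> (cell_of \<alpha> \<tau> (transpose i (Suc i) x)) = x"
    by (simp add: swap_entries_apply[OF d] entry_cell_of[OF assms(1) t])
  then show ?thesis
    using cell_of_eq_iff[OF swap_entries_fillings[OF assms(1,2)] assms(3) d] by simp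
qed

lemma swap_entries_involutory:
  assumes "\<tau> \<in> fillings \<alpha>" "i \<in> {1..<sum_list \<alpha>}"
  shows "swap_entries \<alpha> i (swap_entries \<alpha> i \<tau>) = \<tau>"
  by (rule fillings_eqI[of _ \<alpha>]) (use assms in \<open>auto simp: swap_entries_fillings swap_entries_apply\<close>)

section \<open>The 0-Hecke relations for the operators on fillings\<close>

definition attacking_cells :: "nat \<times> nat \<Rightarrow> nat \<times> nat \<Rightarrow> bool" where
  "attacking_cells P Q \<longleftrightarrow> snd Q = snd P \<or> snd Q = Suc (snd P) \<and> fst P < fst Q"

lemma distinct_columns: "\<not> attacking_cells P Q \<Longrightarrow> snd P \<noteq> snd Q"
  by (simp add: attacking_cells_def)

lemma Des_iff: "i \<in> Des \<alpha> \<tau> \<longleftrightarrow>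
    i \<in> {1..<sum_list \<alpha>} \<and> snd (cell_of \<alpha> \<tau> i) \<le> snd (cell_of \<alpha> \<tau> (Suc i))"
  by (simp add: Des_def col_of_def)

lemma pi_op_eq:
  assumes "i \<in> {1..<sum_list \<alpha>}"
  shows "pi_op \<alpha> i \<tau> =
    (if snd (cell_of \<alpha> \<tau> (Suc i)) < snd (cell_of \<alpha> \<tau> i) then Some \<tau>
     else if attacking_cells (cell_of \<alpha> \<tau> i) (cell_of \<alpha> \<tau> (Suc i)) then None
     else Some (swap_entries \<alpha> i \<tau>))"
  using assms by (auto simp: pi_op_def Des_iff attacking_def attacking_cells_def row_of_def col_of_def)

text \<open>An interchange leaves \<open>i\<close> strictly to the right of \<open>i + 1\<close>, so
  that \<open>i\<close> is no longer a descent and the second application does nothing.\<close>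

lemma pi_op_idem:
  assumes "\<tau> \<in> fillings \<alpha>" "i \<in> {1..<sum_list \<alpha>}"
  shows "Option.bind (pi_op \<alpha> i \<tau>) (pi_op \<alpha> i) = pi_op \<alpha> i \<tau>"
  using assms cell_of_swap_entries[OF assms, of i] cell_of_swap_entries[OF assms, of "Suc i"]
  by (auto simp: pi_op_eq attacking_cells_def)

lemma swap_entries_commute:
  assumes "\<tau> \<in> fillings \<alpha>" "i \<in> {1..<sum_list \<alpha>}" "j \<in> {1..<sum_list \<alpha>}" "Suc i < j"
  shows "swap_entries \<alpha> i (swap_entries \<alpha> j \<tau>) = swap_entries \<alpha> j (swap_entries \<alpha> i \<tau>)"
  by (rule fillings_eqI[of _ \<alpha>])
    (use assms in \<open>auto simp: swap_entries_fillings swap_entries_apply transpose_def\<close>)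

lemma pi_op_commute_less:
  assumes "\<tau> \<in> fillings \<alpha>" "i \<in> {1..<sum_list \<alpha>}" "j \<in> {1..<sum_list \<alpha>}" "Suc i < j"
  shows "Option.bind (pi_op \<alpha> i \<tau>) (pi_op \<alpha> j) = Option.bind (pi_op \<alpha> j \<tau>) (pi_op \<alpha> i)"
proof -
  have "cell_of \<alpha> (swap_entries \<alpha> i \<tau>) j = cell_of \<alpha> \<tau> j"
    "cell_of \<alpha> (swap_entries \<alpha> i \<tau>) (Suc j) = cell_of \<alpha> \<tau> (Suc j)"
    "cell_of \<alpha> (swap_entries \<alpha> j \<tau>) i = cell_of \<alpha> \<tau> i"
    "cell_of \<alpha> (swap_entries \<alpha> j \<tau>) (Suc i) = cell_of \<alpha> \<tau> (Suc i)"
    using assms by (auto simp: cell_of_swap_entries transpose_def)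
  then show ?thesis
    using assms(2,3) by (simp add: pi_op_eq swap_entries_commute[OF assms])
qed

lemma pi_op_commute:
  assumes "\<tau> \<in> fillings \<alpha>" "i \<in> {1..<sum_list \<alpha>}" "j \<in> {1..<sum_list \<alpha>}" "\<bar>int i - int j\<bar> \<ge> 2"
  shows "Option.bind (pi_op \<alpha> i \<tau>) (pi_op \<alpha> j) = Option.bind (pi_op \<alpha> j \<tau>) (pi_op \<alpha> i)"
  using pi_op_commute_less[OF assms(1-3)] pi_op_commute_less[OF assms(1,3,2)] assms(4)
  by (cases "Suc i < j") auto

lemma swap_entries_braid:
  assumes "\<tau> \<in> fillings \<alpha>" "i \<in> {1..<sum_list \<alpha>}" "Suc i \<in> {1..<sum_list \<alpha>}"
  shows "swap_entries \<alpha> i (swap_entries \<alpha> (Suc i) (swap_entries \<alpha> i \<tau>))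
    = swap_entries \<alpha> (Suc i) (swap_entries \<alpha> i (swap_entries \<alpha> (Suc i) \<tau>))"
  by (rule fillings_eqI[of _ \<alpha>])
    (use assms in \<open>auto simp: swap_entries_fillings swap_entries_apply transpose_def\<close>)

text \<open>Each operator reads only the positions of the cells \<open>P\<close>, \<open>Q\<close>,
  \<open>R\<close> of \<open>i\<close>, \<open>i + 1\<close>, \<open>i + 2\<close> and permutes
  their entries. When the cells lie from left to right, both sides test the pairs
  \<open>(P, Q)\<close>, \<open>(P, R)\<close>, \<open>(Q, R)\<close>, in opposite orders. The mixed
  cases are settled by comparing columns, since a non-attacking pair has distinct columns.\<close>

lemma pi_op_braid:
  assumes \<tau>: "\<tau> \<in> fillings \<alpha>" and i: "i \<in> {1..<sum_list \<alpha>}" "Suc i \<in> {1..<sum_list \<alpha>}"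
  shows "Option.bind (Option.bind (pi_op \<alpha> i \<tau>) (pi_op \<alpha> (Suc i))) (pi_op \<alpha> i)
    = Option.bind (Option.bind (pi_op \<alpha> (Suc i) \<tau>) (pi_op \<alpha> i)) (pi_op \<alpha> (Suc i))"
proof -
  obtain P Q R where cells: "cell_of \<alpha> \<tau> i = P" "cell_of \<alpha> \<tau> (Suc i) = Q" "cell_of \<alpha> \<tau> (Suc (Suc i)) = R"
    by blast
  have swap1: "cell_of \<alpha> (swap_entries \<alpha> i \<sigma>) i = cell_of \<alpha> \<sigma> (Suc i)"
    "cell_of \<alpha> (swap_entries \<alpha> i \<sigma>) (Suc i) = cell_of \<alpha> \<sigma> i"
    "cell_of \<alpha> (swap_entries \<alpha> i \<sigma>) (Suc (Suc i)) = cell_of \<alpha> \<sigma> (Suc (Suc i))"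
    "cell_of \<alpha> (swap_entries \<alpha> (Suc i) \<sigma>) i = cell_of \<alpha> \<sigma> i"
    "cell_of \<alpha> (swap_entries \<alpha> (Suc i) \<sigma>) (Suc i) = cell_of \<alpha> \<sigma> (Suc (Suc i))"
    "cell_of \<alpha> (swap_entries \<alpha> (Suc i) \<sigma>) (Suc (Suc i)) = cell_of \<alpha> \<sigma> (Suc i)"
    if "\<sigma> \<in> fillings \<alpha>" for \<sigma>
    using that i by (simp_all add: cell_of_swap_entries transpose_def)
  have fill: "swap_entries \<alpha> i \<sigma> \<in> fillings \<alpha>" "swap_entries \<alpha> (Suc i) \<sigma> \<in> fillings \<alpha>"
    if "\<sigma> \<in> fillings \<alpha>" for \<sigma>
    using that i by (simp_all add: swap_entries_fillings)
  note braid = swap_entries_braid[OF \<tau> i]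
  show ?thesis
    by (cases "snd Q < snd P"; cases "snd R < snd Q"; cases "snd R < snd P";
        cases "attacking_cells P Q"; cases "attacking_cells P R"; cases "attacking_cells Q R")
      (auto simp: pi_op_eq[OF i(1)] pi_op_eq[OF i(2)] swap1 fill \<tau> cells braid dest: distinct_columns)
qed

section \<open>Interchanges that preserve the tableau conditions\<close>

lemma swap_entries_less_iff:
  assumes f: "\<tau> \<in> fillings \<alpha>" and i: "i \<in> {1..<sum_list \<alpha>}"
    and d: "d \<in> diagram \<alpha>" and e: "e \<in> diagram \<alpha>"
    and ne: "{d, e} \<noteq> {cell_of \<alpha> \<tau> i, cell_of \<alpha> \<tau> (Suc i)}"
  shows "swap_entries \<alpha> i \<tau> d < swap_entries \<alpha> i \<tau> e \<longleftrightarrow> \<tau> d < \<tau> e"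
proof -
  have "\<not> (\<tau> d = i \<and> \<tau> e = Suc i)" "\<not> (\<tau> d = Suc i \<and> \<tau> e = i)"
    using ne cell_of_entry[OF f d] cell_of_entry[OF f e] by auto
  then show ?thesis
    using d e by (auto simp: swap_entries_apply transpose_def)
qed

text \<open>Every tableau condition compares two entries, and the swap reverses only the comparison
  between the cells of \<open>i\<close> and \<open>i + 1\<close>. These share no row and no column,
  and in adjacent columns the right one is the higher one, so they never form the pair in the
  premise of the triple rule. The order of \<open>c\<close> and \<open>c'\<close> is left open, so
  one criterion serves both for applying an operator and for undoing it.\<close>

lemma swap_entries_SRCT:
  assumes \<tau>: "\<tau> \<in> SRCT \<alpha>" and i: "i \<in> {1..<sum_list \<alpha>}"
    and cells: "cell_of \<alpha> \<tau> i = (r, c)" "cell_of \<alpha> \<tau> (Suc i) = (r', c')"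
    and rows: "r \<noteq> r'" and col: "c \<noteq> c'"
    and triple: "c' = Suc c \<Longrightarrow> r' < r" "c = Suc c' \<Longrightarrow> r < r'"
  shows "swap_entries \<alpha> i \<tau> \<in> SRCT \<alpha>"
proof -
  note f = SRCT_fillings[OF \<tau>]
  let ?s = "swap_entries \<alpha> i \<tau>"
  have cmp: "?s d < ?s e \<longleftrightarrow> \<tau> d < \<tau> e"
    if "d \<in> diagram \<alpha>" "e \<in> diagram \<alpha>" "{d, e} \<noteq> {(r, c), (r', c')}" for d e
    using swap_entries_less_iff[OF f i that(1,2)] that(3) cells by simp
  show ?thesis
    unfolding SRCT_iff
  proof (intro conjI allI impI)
    show "?s \<in> fillings \<alpha>" by (rule swap_entries_fillings[OF f i])
  next
    fix m j k assume "j < k \<and> (m, j) \<in> diagram \<alpha> \<and> (m, k) \<in> diagram \<alpha>"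
    then show "?s (m, k) < ?s (m, j)"
      using cmp[of "(m, k)" "(m, j)"] SRCT_row[OF \<tau>] rows by (auto simp: doubleton_eq_iff)
  next
    fix m j assume "m < j \<and> (m, 0) \<in> diagram \<alpha> \<and> (j, 0) \<in> diagram \<alpha>"
    moreover have "{(m, 0), (j, 0)} \<noteq> {(r, c), (r', c')}"
      using col by (auto simp: doubleton_eq_iff)
    ultimately show "?s (m, 0) < ?s (j, 0)"
      using cmp[of "(m, 0)" "(j, 0)"] SRCT_first_column[OF \<tau>] by simp
  next
    fix m j k
    assume a: "m < j \<and> (m, k) \<in> diagram \<alpha> \<and> (j, k + 1) \<in> diagram \<alpha> \<and> ?s (j, k + 1) < ?s (m, k)"
    have "{(j, k + 1), (m, k)} \<noteq> {(r, c), (r', c')}"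
      using a triple by (auto simp: doubleton_eq_iff)
    then have "\<tau> (j, Suc k) < \<tau> (m, k)" using a cmp[of "(j, Suc k)" "(m, k)"] by simp
    then have "(m, Suc k) \<in> diagram \<alpha>" "\<tau> (j, Suc k) < \<tau> (m, Suc k)"
      using SRCT_triple[OF \<tau>, of m j k] a by auto
    moreover have "{(j, Suc k), (m, Suc k)} \<noteq> {(r, c), (r', c')}"
      using col by (auto simp: doubleton_eq_iff)
    ultimately show "(m, k + 1) \<in> diagram \<alpha>" "?s (j, k + 1) < ?s (m, k + 1)"
      using a cmp[of "(j, Suc k)" "(m, Suc k)"] by simp_all
  qed
qed

lemma pi_op_SRCT:
  assumes \<tau>: "\<tau> \<in> SRCT \<alpha>" and "pi_op \<alpha> i \<tau> = Some \<sigma>"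
  shows "\<sigma> \<in> SRCT \<alpha>"
proof (cases "i \<in> Des \<alpha> \<tau>")
  case False
  then show ?thesis using assms by (simp add: pi_op_def)
next
  case True
  note f = SRCT_fillings[OF \<tau>]
  from True have i: "i \<in> {1..<sum_list \<alpha>}" by (simp add: Des_iff)
  obtain r c r' c' where cells: "cell_of \<alpha> \<tau> i = (r, c)" "cell_of \<alpha> \<tau> (Suc i) = (r', c')"
    by fastforce
  have le: "c \<le> c'" using True cells by (simp add: Des_iff)
  have na: "\<not> attacking_cells (r, c) (r', c')" and \<sigma>: "\<sigma> = swap_entries \<alpha> i \<tau>"
    using assms(2) le unfolding pi_op_eq[OF i] cells by (auto split: if_splits)
  have d: "(r, c) \<in> diagram \<alpha>" "(r', c') \<in> diagram \<alpha>" "\<tau> (r, c) = i" "\<tau> (r', c') = Suc i"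
    using cell_of_diagram[OF f, of i] cell_of_diagram[OF f, of "Suc i"]
      entry_cell_of[OF f, of i] entry_cell_of[OF f, of "Suc i"] i cells by auto
  have lt: "c < c'" using le na by (auto simp: attacking_cells_def)
  have rows: "r \<noteq> r'" using SRCT_row[OF \<tau> lt] d by fastforce
  show ?thesis
    unfolding \<sigma> by (rule swap_entries_SRCT[OF \<tau> i cells]) (use na lt rows in \<open>auto simp: attacking_cells_def\<close>)
qed

text \<open>Undoes an operator. The excluded position, \<open>i\<close> immediately to the right of
  \<open>i + 1\<close>, is where a swap would break the row order. Other bad positions cannot occur,
  as they force an entry strictly between \<open>i\<close> and \<open>i + 1\<close>: in a common
  row, the cell right after \<open>i + 1\<close>; in adjacent columns with \<open>r' < r\<close>,
  the cell \<open>(r', c)\<close> supplied by the triple rule.\<close>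

lemma pi_op_ascent:
  assumes \<tau>: "\<tau> \<in> SRCT \<alpha>" and i: "i \<in> {1..<sum_list \<alpha>}"
    and cells: "cell_of \<alpha> \<tau> i = (r, c)" "cell_of \<alpha> \<tau> (Suc i) = (r', c')"
    and lt: "c' < c" and nonadj: "(r, c) \<noteq> (r', Suc c')"
  shows "swap_entries \<alpha> i \<tau> \<in> SRCT \<alpha>" "pi_op \<alpha> i (swap_entries \<alpha> i \<tau>) = Some \<tau>"
proof -
  note f = SRCT_fillings[OF \<tau>]
  have d: "(r, c) \<in> diagram \<alpha>" "(r', c') \<in> diagram \<alpha>" "\<tau> (r, c) = i" "\<tau> (r', c') = Suc i"
    using cell_of_diagram[OF f, of i] cell_of_diagram[OF f, of "Suc i"]
      entry_cell_of[OF f, of i] entry_cell_of[OF f, of "Suc i"] i cells by auto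
  have rows: "r \<noteq> r'"
  proof
    assume "r = r'"
    then have l: "Suc c' < c" using lt nonadj by auto
    have "(r, Suc c') \<in> diagram \<alpha>" using d(1) l by (auto intro: diagram_left)
    then have "\<tau> (r, Suc c') < \<tau> (r', c')" "\<tau> (r, c) < \<tau> (r, Suc c')"
      using SRCT_row[OF \<tau>, of c' "Suc c'" r] SRCT_row[OF \<tau> l, of r] d \<open>r = r'\<close> by auto
    then show False using d by simp
  qed
  have tr: "r < r'" if "c = Suc c'"
  proof (rule ccontr)
    assume "\<not> r < r'"
    then have "r' < r" using rows by simp
    from SRCT_triple[OF \<tau> this d(2), unfolded that[symmetric], OF d(1)] d
    have r: "(r', c) \<in> diagram \<alpha>" "i < \<tau> (r', c)" by simp_all
    then have "\<tau> (r', c) < Suc i" using SRCT_row[OF \<tau> lt d(2)] d by simp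
    then show False using r by simp
  qed
  show "swap_entries \<alpha> i \<tau> \<in> SRCT \<alpha>"
    by (rule swap_entries_SRCT[OF \<tau> i cells]) (use tr lt rows in auto)
  show "pi_op \<alpha> i (swap_entries \<alpha> i \<tau>) = Some \<tau>"
    using i lt tr cells by (auto simp: pi_op_eq cell_of_swap_entries[OF f] attacking_cells_def swap_entries_involutory[OF f])
qed

section \<open>The module\<close>

lemma pi_linear_spanned: "v \<in> spanned (SRCT \<alpha>) \<Longrightarrow> pi_linear \<alpha> i v \<in> spanned (SRCT \<alpha>)"
  unfolding pi_linear_eq_push by (rule push_spanned) (auto intro: pi_op_SRCT)

lemma free_action_spanned:
  assumes "v \<in> spanned (SRCT \<alpha>)"
  shows "free_action \<alpha> f v \<in> spanned (SRCT \<alpha>)"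
proof -
  have "foldr (pi_linear \<alpha>) w v \<in> spanned (SRCT \<alpha>)" for w
    using assms by (induction w) (auto intro: pi_linear_spanned)
  then show ?thesis by (auto simp: free_action_def spanned_def)
qed

lemma pi_linear_pi_linear:
  "pi_linear \<alpha> j (pi_linear \<alpha> i v) = push \<alpha> (\<lambda>\<tau>. Option.bind (pi_op \<alpha> i \<tau>) (pi_op \<alpha> j)) v"
  unfolding pi_linear_eq_push by (rule push_push) (rule pi_op_SRCT)

lemma pi_linear_3:
  "pi_linear \<alpha> k (pi_linear \<alpha> j (pi_linear \<alpha> i v))
    = push \<alpha> (\<lambda>\<tau>. Option.bind (Option.bind (pi_op \<alpha> i \<tau>) (pi_op \<alpha> j)) (pi_op \<alpha> k)) v"
  unfolding pi_linear_pi_linear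
  by (subst pi_linear_eq_push, rule push_push) (auto simp: bind_eq_Some_conv intro: pi_op_SRCT)

lemma pi_linear_idem:
  "i \<in> {1..<sum_list \<alpha>} \<Longrightarrow> pi_linear \<alpha> i (pi_linear \<alpha> i v) = pi_linear \<alpha> i v"
  unfolding pi_linear_pi_linear unfolding pi_linear_eq_push
  by (rule push_cong) (auto simp: pi_op_idem SRCT_fillings)

lemma pi_linear_commute:
  "i \<in> {1..<sum_list \<alpha>} \<Longrightarrow> j \<in> {1..<sum_list \<alpha>} \<Longrightarrow> \<bar>int i - int j\<bar> \<ge> 2 \<Longrightarrow>
    pi_linear \<alpha> i (pi_linear \<alpha> j v) = pi_linear \<alpha> j (pi_linear \<alpha> i v)"
  unfolding pi_linear_pi_linear
  by (rule push_cong) (rule pi_op_commute[symmetric], auto simp: SRCT_fillings)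

lemma pi_linear_braid:
  "i \<in> {1..<sum_list \<alpha>} \<Longrightarrow> Suc i \<in> {1..<sum_list \<alpha>} \<Longrightarrow>
    pi_linear \<alpha> i (pi_linear \<alpha> (Suc i) (pi_linear \<alpha> i v))
    = pi_linear \<alpha> (Suc i) (pi_linear \<alpha> i (pi_linear \<alpha> (Suc i) v))"
  unfolding pi_linear_3
  by (rule push_cong) (rule pi_op_braid, auto simp: SRCT_fillings)

section \<open>The relation ideal acts by zero\<close>

definition annihilator :: "nat list \<Rightarrow> (nat list \<Rightarrow> complex) set" where
  "annihilator \<alpha> = {f \<in> carrier (free_algebra (sum_list \<alpha>)).
     \<forall>v\<in>spanned (SRCT \<alpha>). free_action \<alpha> f v = (\<lambda>_. 0)}"

lemma a_inv_free_algebra: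
  assumes "f \<in> carrier (free_algebra n)"
  shows "\<ominus>\<^bsub>free_algebra n\<^esub> f = (\<lambda>w. - f w)"
proof -
  interpret ring "free_algebra n" by (rule ring_free_algebra)
  show ?thesis
    by (rule minus_equality) (use assms in \<open>auto simp: free_algebra_simps\<close>)
qed

lemma annihilator_iff:
  "f \<in> annihilator \<alpha> \<longleftrightarrow> f \<in> carrier (free_algebra (sum_list \<alpha>)) \<and>
     (\<forall>v\<in>spanned (SRCT \<alpha>). free_action \<alpha> f v = (\<lambda>_. 0))"
  by (simp add: annihilator_def)

lemma finite_supp_free_algebra: "f \<in> carrier (free_algebra n) \<Longrightarrow> finite (supp f)"
  by (simp add: free_algebra_simps)

text \<open>A factor applied afterwards sends zero to zero; a factor applied before keeps the vector
  in the span, where \<open>f\<close> vanishes. Being a two-sided ideal, the annihilator contains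
  the ideal generated by the relators as soon as it contains the relators.\<close>

lemma ideal_annihilator: "ideal (annihilator \<alpha>) (free_algebra (sum_list \<alpha>))"
proof -
  let ?R = "free_algebra (sum_list \<alpha>)"
  interpret ring ?R by (rule ring_free_algebra)
  have carr: "f \<in> carrier ?R" if "f \<in> annihilator \<alpha>" for f
    using that by (simp add: annihilator_iff)
  have zero: "free_action \<alpha> f v = (\<lambda>_. 0)" if "f \<in> annihilator \<alpha>" "v \<in> spanned (SRCT \<alpha>)" for f v
    using that by (simp add: annihilator_iff)
  note fin = finite_supp_free_algebra
  have "subgroup (annihilator \<alpha>) (add_monoid ?R)"
  proof
    show "annihilator \<alpha> \<subseteq> carrier (add_monoid ?R)" using carr by auto
    show "\<one>\<^bsub>add_monoid ?R\<^esub> \<in> annihilator \<alpha>"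
      by (simp add: annihilator_iff) (simp add: free_algebra_simps(4) free_action_def)
    fix f assume f: "f \<in> annihilator \<alpha>"
    have "free_action \<alpha> (\<ominus>\<^bsub>?R\<^esub> f) v = (\<lambda>_. 0)" if "v \<in> spanned (SRCT \<alpha>)" for v
      by (simp add: a_inv_free_algebra[OF carr[OF f]] free_action_uminus zero[OF f that])
    then show "inv\<^bsub>add_monoid ?R\<^esub> f \<in> annihilator \<alpha>"
      using carr[OF f] unfolding a_inv_def[symmetric] by (simp add: annihilator_iff)
    fix g assume g: "g \<in> annihilator \<alpha>"
    have "free_action \<alpha> (f \<oplus>\<^bsub>?R\<^esub> g) v = (\<lambda>_. 0)" if "v \<in> spanned (SRCT \<alpha>)" for v
      unfolding free_algebra_simps(5) free_action_add[OF fin[OF carr[OF f]] fin[OF carr[OF g]]]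
      by (simp add: zero[OF f that] zero[OF g that])
    then show "f \<otimes>\<^bsub>add_monoid ?R\<^esub> g \<in> annihilator \<alpha>"
      using carr[OF f] carr[OF g] by (simp add: annihilator_iff)
  qed
  moreover have "g \<otimes>\<^bsub>?R\<^esub> f \<in> annihilator \<alpha>" "f \<otimes>\<^bsub>?R\<^esub> g \<in> annihilator \<alpha>"
    if f: "f \<in> annihilator \<alpha>" and g: "g \<in> carrier ?R" for f g
  proof -
    have "free_action \<alpha> (g \<otimes>\<^bsub>?R\<^esub> f) v = (\<lambda>_. 0)" "free_action \<alpha> (f \<otimes>\<^bsub>?R\<^esub> g) v = (\<lambda>_. 0)"
      if v: "v \<in> spanned (SRCT \<alpha>)" for v
      unfolding free_algebra_simps(2) free_action_convolution[OF fin[OF g] fin[OF carr[OF f]]]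
        free_action_convolution[OF fin[OF carr[OF f]] fin[OF g]]
      by (simp_all add: zero[OF f v] zero[OF f free_action_spanned[OF v]] free_action_zero)
    then show "g \<otimes>\<^bsub>?R\<^esub> f \<in> annihilator \<alpha>" "f \<otimes>\<^bsub>?R\<^esub> g \<in> annihilator \<alpha>"
      using carr[OF f] g by (simp_all add: annihilator_iff)
  qed
  ultimately show ?thesis by (intro idealI ring_free_algebra)
qed

lemma word_diff_carrier:
  assumes "set u \<subseteq> {1..<n}" "set w \<subseteq> {1..<n}"
  shows "word_diff u w \<in> carrier (free_algebra n)"
proof -
  have "supp (word_diff u w) \<subseteq> {u, w}" by (auto simp: word_diff_def)
  then have "finite (supp (word_diff u w))" by (rule finite_subset) simp
  then show ?thesis using assms by (auto simp: free_algebra_simps word_diff_def split: if_splits)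
qed

lemma word_diff_annihilator:
  assumes "set u \<subseteq> {1..<sum_list \<alpha>}" "set w \<subseteq> {1..<sum_list \<alpha>}" "u \<noteq> w"
    and "\<And>v. foldr (pi_linear \<alpha>) u v = foldr (pi_linear \<alpha>) w v"
  shows "word_diff u w \<in> annihilator \<alpha>"
  using assms by (simp add: annihilator_def word_diff_carrier free_action_word_diff)

lemma hecke0_relators_annihilator: "hecke0_relators (sum_list \<alpha>) \<subseteq> annihilator \<alpha>"
  unfolding hecke0_relators_def
proof (intro Un_least subsetI; clarify)
  fix i assume "i \<in> {1..<sum_list \<alpha>}"
  then show "word_diff [i, i] [i] \<in> annihilator \<alpha>"
    by (intro word_diff_annihilator) (auto simp: pi_linear_idem)
next
  fix i assume "i \<in> {1..<sum_list \<alpha>}" "i + 1 \<in> {1..<sum_list \<alpha>}"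
  then show "word_diff [i, i + 1, i] [i + 1, i, i + 1] \<in> annihilator \<alpha>"
    by (intro word_diff_annihilator) (auto simp: pi_linear_braid)
next
  fix i j assume "i \<in> {1..<sum_list \<alpha>}" "j \<in> {1..<sum_list \<alpha>}" "\<bar>int i - int j\<bar> \<ge> 2"
  then show "word_diff [i, j] [j, i] \<in> annihilator \<alpha>"
    by (intro word_diff_annihilator) (auto simp: pi_linear_commute)
qed

lemma SRCT_module_simps:
  "carrier (SRCT_module \<alpha>) = spanned (SRCT \<alpha>)"
  "\<zero>\<^bsub>SRCT_module \<alpha>\<^esub> = (\<lambda>_. 0)"
  "u \<oplus>\<^bsub>SRCT_module \<alpha>\<^esub> v = (\<lambda>\<tau>. u \<tau> + v \<tau>)"
  "X \<odot>\<^bsub>SRCT_module \<alpha>\<^esub> v = the_elem ((\<lambda>f. free_action \<alpha> f v) ` X)"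
  by (simp_all add: SRCT_module_def spanned_def)

definition hecke0_class :: "nat \<Rightarrow> (nat list \<Rightarrow> complex) \<Rightarrow> (nat list \<Rightarrow> complex) set" where
  "hecke0_class n f = (Idl\<^bsub>free_algebra n\<^esub> (hecke0_relators n)) +>\<^bsub>free_algebra n\<^esub> f"

lemma carrier_hecke0: "carrier (hecke0 n) = hecke0_class n ` carrier (free_algebra n)"
  by (auto simp: hecke0_def FactRing_def hecke0_class_def A_RCOSETS_def' a_r_coset_def')

text \<open>Representatives of a coset differ by elements of the relation ideal, which lies in
  \<open>annihilator \<alpha>\<close>. They act alike on the span, and \<open>the_elem\<close>
  returns the common value.\<close>

lemma smult_hecke0_class:
  assumes f: "f \<in> carrier (free_algebra (sum_list \<alpha>))" and v: "v \<in> spanned (SRCT \<alpha>)"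
  shows "hecke0_class (sum_list \<alpha>) f \<odot>\<^bsub>SRCT_module \<alpha>\<^esub> v = free_action \<alpha> f v"
proof -
  let ?R = "free_algebra (sum_list \<alpha>)"
  let ?I = "Idl\<^bsub>?R\<^esub> (hecke0_relators (sum_list \<alpha>))"
  interpret ring ?R by (rule ring_free_algebra)
  have sub: "?I \<subseteq> annihilator \<alpha>"
    unfolding genideal_def using ideal_annihilator hecke0_relators_annihilator by blast
  \<comment> \<open>An empty ideal would make the image under \<open>the_elem\<close> empty instead
    of a singleton.\<close>
  have "\<zero>\<^bsub>?R\<^esub> \<in> ?I"
    unfolding genideal_def using additive_subgroup.zero_closed ideal.axioms(1) by blast
  then have ne: "?I \<noteq> {}" by blast
  have const: "free_action \<alpha> (h \<oplus>\<^bsub>?R\<^esub> f) v = free_action \<alpha> f v" if "h \<in> ?I" for h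
  proof -
    have "h \<in> annihilator \<alpha>" using that sub by blast
    then have "h \<in> carrier ?R" "free_action \<alpha> h v = (\<lambda>_. 0)" using v by (auto simp: annihilator_def)
    moreover from this(1) f have "finite (supp h)" "finite (supp f)"
      by (simp_all add: free_algebra_simps)
    ultimately show ?thesis by (simp add: free_algebra_simps(5) free_action_add)
  qed
  have "hecke0_class (sum_list \<alpha>) f = (\<lambda>h. h \<oplus>\<^bsub>?R\<^esub> f) ` ?I"
    unfolding hecke0_class_def a_r_coset_def' by blast
  then have "(\<lambda>f. free_action \<alpha> f v) ` hecke0_class (sum_list \<alpha>) f
      = (\<lambda>h. free_action \<alpha> (h \<oplus>\<^bsub>?R\<^esub> f) v) ` ?I"
    by (simp only: image_image)
  also have "\<dots> = (\<lambda>h. free_action \<alpha> f v) ` ?I" by (rule image_cong[OF refl const])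
  also have "\<dots> = {free_action \<alpha> f v}" using ne by (rule image_constant_conv[THEN trans, OF if_not_P])
  finally show ?thesis by (simp only: SRCT_module_simps the_elem_eq)
qed

section \<open>Submodules as subspaces stable under the operators\<close>

definition invariant_subspace :: "nat list \<Rightarrow> (tableau \<Rightarrow> complex) set \<Rightarrow> bool" where
  "invariant_subspace \<alpha> A \<longleftrightarrow> A \<subseteq> spanned (SRCT \<alpha>) \<and> (\<lambda>_. 0) \<in> A \<and>
     (\<forall>u\<in>A. \<forall>v\<in>A. (\<lambda>\<tau>. u \<tau> + v \<tau>) \<in> A) \<and> (\<forall>c. \<forall>v\<in>A. (\<lambda>\<tau>. c * v \<tau>) \<in> A) \<and>
     (\<forall>i\<in>{1..<sum_list \<alpha>}. \<forall>v\<in>A. pi_linear \<alpha> i v \<in> A)"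

lemma invariant_subspaceD:
  assumes "invariant_subspace \<alpha> A"
  shows invariant_subset: "A \<subseteq> spanned (SRCT \<alpha>)"
    and invariant_zero: "(\<lambda>_. 0) \<in> A"
    and invariant_add: "u \<in> A \<Longrightarrow> v \<in> A \<Longrightarrow> (\<lambda>\<tau>. u \<tau> + v \<tau>) \<in> A"
    and invariant_scale: "v \<in> A \<Longrightarrow> (\<lambda>\<tau>. c * v \<tau>) \<in> A"
    and invariant_pi: "i \<in> {1..<sum_list \<alpha>} \<Longrightarrow> v \<in> A \<Longrightarrow> pi_linear \<alpha> i v \<in> A"
  using assms unfolding invariant_subspace_def by blast+

lemma group_SRCT_module: "group (add_monoid (SRCT_module \<alpha>))"
proof (rule groupI)
  fix v assume v: "v \<in> carrier (add_monoid (SRCT_module \<alpha>))"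
  show "\<exists>u\<in>carrier (add_monoid (SRCT_module \<alpha>)).
      u \<otimes>\<^bsub>add_monoid (SRCT_module \<alpha>)\<^esub> v = \<one>\<^bsub>add_monoid (SRCT_module \<alpha>)\<^esub>"
    by (rule bexI[where x = "\<lambda>\<tau>. - v \<tau>"]) (use v in \<open>auto simp: SRCT_module_simps spanned_def\<close>)
qed (auto simp: SRCT_module_simps spanned_def algebra_simps)

text \<open>Multiples of the empty word give the scalars and single letters give the operators.
  Conversely, every algebra element acts as a finite linear combination of composites of
  operators.\<close>

lemma submodule_iff:
  "submodule A (hecke0 (sum_list \<alpha>)) (SRCT_module \<alpha>) \<longleftrightarrow> invariant_subspace \<alpha> A"
proof
  assume "submodule A (hecke0 (sum_list \<alpha>)) (SRCT_module \<alpha>)"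
  then interpret submodule A "hecke0 (sum_list \<alpha>)" "SRCT_module \<alpha>" .
  have sub: "A \<subseteq> spanned (SRCT \<alpha>)" using subset by (simp add: SRCT_module_simps)
  have act: "free_action \<alpha> f v \<in> A" if "f \<in> carrier (free_algebra (sum_list \<alpha>))" "v \<in> A" for f v
  proof -
    have "hecke0_class (sum_list \<alpha>) f \<odot>\<^bsub>SRCT_module \<alpha>\<^esub> v \<in> A"
      using that by (intro smult_closed) (auto simp: carrier_hecke0)
    then show ?thesis using smult_hecke0_class[OF that(1), of v] sub that(2) by (simp only: subsetD)
  qed
  have scale: "(\<lambda>\<tau>. c * v \<tau>) \<in> A" if "v \<in> A" for c v
  proof -
    have "free_action \<alpha> (\<lambda>w. if w = [] then c else 0) v = (\<lambda>\<tau>. c * v \<tau>)"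
      by (cases "c = 0") (auto simp: free_action_def)
    moreover have "(\<lambda>w. if w = [] then c else 0) \<in> carrier (free_algebra (sum_list \<alpha>))"
      by (cases "c = 0") (auto simp: free_algebra_simps)
    ultimately show ?thesis using act[OF _ that] by metis
  qed
  have pi: "pi_linear \<alpha> i v \<in> A" if "v \<in> A" "i \<in> {1..<sum_list \<alpha>}" for i v
  proof -
    have "free_action \<alpha> (\<lambda>w. if w = [i] then 1 else 0) v = pi_linear \<alpha> i v"
      by (auto simp: free_action_def)
    moreover have "(\<lambda>w. if w = [i] then 1 else 0) \<in> carrier (free_algebra (sum_list \<alpha>))"
      using that(2) by (auto simp: free_algebra_simps)
    ultimately show ?thesis using act[OF _ that(1)] by metis
  qed
  have add: "(\<lambda>\<tau>. u \<tau> + v \<tau>) \<in> A" if "u \<in> A" "v \<in> A" for u v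
    using m_closed[OF that] by (simp add: SRCT_module_simps)
  have zero: "(\<lambda>_. 0) \<in> A" using one_closed by (simp add: SRCT_module_simps)
  show "invariant_subspace \<alpha> A"
    unfolding invariant_subspace_def by (intro conjI ballI allI sub zero add scale pi)
next
  assume A: "invariant_subspace \<alpha> A"
  note sub = invariant_subset[OF A]
  have sum: "(\<lambda>\<tau>. \<Sum>w\<in>W. c w * x w \<tau>) \<in> A" if "\<And>w. w \<in> W \<Longrightarrow> x w \<in> A" "finite W"
    for W :: "nat list set" and c x
    using that(2,1)
  proof (induction W)
    case empty
    then show ?case using invariant_zero[OF A] by simp
  next
    case (insert w W)
    have "(\<lambda>\<tau>. c w * x w \<tau> + (\<Sum>w\<in>W. c w * x w \<tau>)) \<in> A"
      by (rule invariant_add[OF A invariant_scale[OF A]]) (use insert in auto)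
    then show ?case using insert by simp
  qed
  have inv: "inv\<^bsub>add_monoid (SRCT_module \<alpha>)\<^esub> v = (\<lambda>\<tau>. (-1) * v \<tau>)" if "v \<in> A" for v
    by (rule group.inv_equality[OF group_SRCT_module])
      (use that sub in \<open>auto simp: SRCT_module_simps spanned_def\<close>)
  have "subgroup A (add_monoid (SRCT_module \<alpha>))"
  proof
    fix v assume "v \<in> A"
    then show "inv\<^bsub>add_monoid (SRCT_module \<alpha>)\<^esub> v \<in> A"
      by (simp only: inv invariant_scale[OF A])
  next
    show "A \<subseteq> carrier (add_monoid (SRCT_module \<alpha>))" using sub by (simp add: SRCT_module_simps)
    show "\<one>\<^bsub>add_monoid (SRCT_module \<alpha>)\<^esub> \<in> A" using invariant_zero[OF A] by (simp add: SRCT_module_simps)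
    show "u \<otimes>\<^bsub>add_monoid (SRCT_module \<alpha>)\<^esub> v \<in> A" if "u \<in> A" "v \<in> A" for u v
      using invariant_add[OF A that] by (simp add: SRCT_module_simps)
  qed
  moreover have "X \<odot>\<^bsub>SRCT_module \<alpha>\<^esub> v \<in> A"
    if X: "X \<in> carrier (hecke0 (sum_list \<alpha>))" and v: "v \<in> A" for X v
  proof -
    obtain f where f: "f \<in> carrier (free_algebra (sum_list \<alpha>))" "X = hecke0_class (sum_list \<alpha>) f"
      using X by (auto simp: carrier_hecke0)
    have fold: "foldr (pi_linear \<alpha>) w v \<in> A" if "set w \<subseteq> {1..<sum_list \<alpha>}" for w
      using that v by (induction w) (simp_all add: invariant_pi[OF A])
    have "free_action \<alpha> f v \<in> A"
      unfolding free_action_def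
    proof (rule sum)
      show "foldr (pi_linear \<alpha>) w v \<in> A" if "w \<in> supp f" for w
        by (rule fold) (use f(1) that in \<open>simp add: free_algebra_simps\<close>)
      show "finite (supp f)" using f(1) by (simp add: free_algebra_simps)
    qed
    then show ?thesis by (simp only: f(2) smult_hecke0_class[OF f(1) subsetD[OF sub v]])
  qed
  ultimately show "submodule A (hecke0 (sum_list \<alpha>)) (SRCT_module \<alpha>)"
    by (intro submodule.intro submodule_axioms.intro)
qed

lemma indecomposable_iff:
  "indecomposable_module (hecke0 (sum_list \<alpha>)) (SRCT_module \<alpha>) \<longleftrightarrow>
     SRCT \<alpha> \<noteq> {} \<and>
     \<not> (\<exists>A B. invariant_subspace \<alpha> A \<and> invariant_subspace \<alpha> B \<and> A \<noteq> {\<lambda>_. 0} \<and> B \<noteq> {\<lambda>_. 0} \<and>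
          A \<inter> B = {\<lambda>_. 0} \<and> {\<lambda>\<tau>. u \<tau> + v \<tau> | u v. u \<in> A \<and> v \<in> B} = spanned (SRCT \<alpha>))"
proof -
  have "spanned (SRCT \<alpha>) = {\<lambda>_. 0} \<longleftrightarrow> SRCT \<alpha> = {}"
  proof
    assume *: "spanned (SRCT \<alpha>) = {\<lambda>_. 0}"
    show "SRCT \<alpha> = {}"
    proof (rule ccontr)
      assume "SRCT \<alpha> \<noteq> {}"
      then obtain \<tau> where "\<tau> \<in> SRCT \<alpha>" by blast
      then have "(\<lambda>\<sigma>. if \<sigma> = \<tau> then 1 else 0) \<in> spanned (SRCT \<alpha>)" by (auto simp: spanned_def)
      then have "(\<lambda>\<sigma>. if \<sigma> = \<tau> then 1 else (0 :: complex)) = (\<lambda>_. 0)" using * by blast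
      then show False by (metis zero_neq_one)
    qed
  qed (auto simp: spanned_def)
  moreover have "A <+>\<^bsub>SRCT_module \<alpha>\<^esub> B = {\<lambda>\<tau>. u \<tau> + v \<tau> | u v. u \<in> A \<and> v \<in> B}" for A B
    by (auto simp: set_add_def' SRCT_module_simps)
  ultimately show ?thesis
    unfolding indecomposable_module_def submodule_iff SRCT_module_simps by simp
qed

section \<open>Tableaux with increasing columns\<close>

definition columns_increasing :: "nat list \<Rightarrow> tableau \<Rightarrow> bool" where
  "columns_increasing \<alpha> \<tau> \<longleftrightarrow>
     (\<forall>i j k. i < j \<and> (i, k) \<in> diagram \<alpha> \<and> (j, k) \<in> diagram \<alpha> \<longrightarrow> \<tau> (i, k) < \<tau> (j, k))"

text \<open>The only comparison reversed by the swap is the one between \<open>i\<close> and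
  \<open>i + 1\<close>, and a non-attacking pair lies in different columns.\<close>

lemma pi_op_columns_increasing:
  assumes \<tau>: "\<tau> \<in> SRCT \<alpha>" and op: "pi_op \<alpha> i \<tau> = Some \<sigma>"
  shows "columns_increasing \<alpha> \<sigma> \<longleftrightarrow> columns_increasing \<alpha> \<tau>"
proof (cases "i \<in> Des \<alpha> \<tau>")
  case False
  then show ?thesis using op by (simp add: pi_op_def)
next
  case True
  then have i: "i \<in> {1..<sum_list \<alpha>}" by (simp add: Des_iff)
  note f = SRCT_fillings[OF \<tau>]
  have \<sigma>: "\<sigma> = swap_entries \<alpha> i \<tau>" and ne: "snd (cell_of \<alpha> \<tau> i) \<noteq> snd (cell_of \<alpha> \<tau> (Suc i))"
    using op True unfolding pi_op_eq[OF i] by (auto simp: Des_iff dest: distinct_columns split: if_splits)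
  have "\<sigma> (m, k) < \<sigma> (j, k) \<longleftrightarrow> \<tau> (m, k) < \<tau> (j, k)"
    if "(m, k) \<in> diagram \<alpha>" "(j, k) \<in> diagram \<alpha>" for m j k
    unfolding \<sigma> by (rule swap_entries_less_iff[OF f i that]) (use ne in \<open>metis doubleton_eq_iff snd_conv\<close>)
  then show ?thesis by (auto simp: columns_increasing_def)
qed

text \<open>An inversion in some column propagates along the lower row to its last cell; there simplicity
  produces a shorter row in between that carries an inversion in the column before.\<close>

lemma simple_columns_increasing:
  assumes simple: "simple_composition \<alpha>" and \<tau>: "\<tau> \<in> SRCT \<alpha>"
  shows "columns_increasing \<alpha> \<tau>"
proof -
  note f = SRCT_fillings[OF \<tau>]
  have last: "\<tau> (i, c) < \<tau> (j, c)"
    if "i < j" "(i, c) \<in> diagram \<alpha>" "(j, c) \<in> diagram \<alpha>" "\<alpha> ! j = Suc c" for i j c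
    using that
  proof (induction c arbitrary: i j)
    case 0
    then show ?case using SRCT_first_column[OF \<tau>] by simp
  next
    case (Suc b)
    show ?case
    proof (rule ccontr)
      assume "\<not> \<tau> (i, Suc b) < \<tau> (j, Suc b)"
      moreover have "\<tau> (i, Suc b) \<noteq> \<tau> (j, Suc b)"
        using entry_inject[OF f Suc.prems(2,3)] Suc.prems(1) by simp
      ultimately have inv: "\<tau> (j, Suc b) < \<tau> (i, Suc b)" by simp
      have "\<alpha> ! j \<le> \<alpha> ! i" "j < length \<alpha>" "2 \<le> \<alpha> ! j"
        using Suc.prems by (auto simp: diagram_def)
      then obtain k where k: "i < k" "k < j" "\<alpha> ! k = Suc b"
        using simple[unfolded simple_composition_def, rule_format, of i j] Suc.prems(1,4) by auto
      have kd: "(k, b) \<in> diagram \<alpha>" "(k, Suc b) \<notin> diagram \<alpha>"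
        using k(2,3) \<open>j < length \<alpha>\<close> by (simp_all add: diagram_def)
      \<comment> \<open>Row \<open>k\<close> stops in column \<open>b\<close>, so the triple rule
        forbids \<open>\<tau> (k, b)\<close> to exceed \<open>\<tau> (j, Suc b)\<close>. Chained
        with the inversion and the decrease along row \<open>i\<close>, this contradicts the
        induction hypothesis for the rows \<open>i\<close> and \<open>k\<close>.\<close>
      have "\<not> \<tau> (j, Suc b) < \<tau> (k, b)"
        using SRCT_triple(1)[OF \<tau> k(2) kd(1) Suc.prems(3)] kd(2) by blast
      moreover have "\<tau> (i, Suc b) < \<tau> (i, b)"
        using SRCT_row[OF \<tau> _ diagram_left[OF Suc.prems(2)] Suc.prems(2), of b] by simp
      moreover have "\<tau> (i, b) < \<tau> (k, b)"
        by (rule Suc.IH) (use k kd diagram_left[OF Suc.prems(2), of b] in simp_all)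
      ultimately show False using inv by simp
    qed
  qed
  have "\<tau> (i, k) < \<tau> (j, k)"
    if "i < j" "(i, k) \<in> diagram \<alpha>" "(j, k) \<in> diagram \<alpha>" for i j k
    using that
  proof (induction "\<alpha> ! j - k" arbitrary: k)
    case 0
    then show ?case by (simp add: diagram_def)
  next
    case (Suc n)
    show ?case
    proof (cases "\<alpha> ! j = Suc k")
      case True
      then show ?thesis using last Suc.prems by blast
    next
      case False
      have d: "(j, Suc k) \<in> diagram \<alpha>" using False Suc.prems by (auto simp: diagram_def)
      show ?thesis
      proof (rule ccontr)
        assume "\<not> \<tau> (i, k) < \<tau> (j, k)"
        moreover have "\<tau> (j, Suc k) < \<tau> (j, k)" using SRCT_row[OF \<tau> _ Suc.prems(3) d] by simp
        ultimately have "\<tau> (j, Suc k) < \<tau> (i, k)" by simp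
        note tr = SRCT_triple[OF \<tau> Suc.prems(1,2) d this]
        have "\<tau> (i, Suc k) < \<tau> (j, Suc k)"
          by (rule Suc.hyps(1)) (use Suc.hyps(2) Suc.prems(1) tr(1) d in auto)
        then show False using tr(2) by simp
      qed
    qed
  qed
  then show ?thesis by (auto simp: columns_increasing_def)
qed

section \<open>The row-by-row tableau\<close>

definition psum :: "nat list \<Rightarrow> nat \<Rightarrow> nat" where
  "psum \<alpha> i = sum_list (take i \<alpha>)"

text \<open>Row \<open>i\<close> receives the block
  \<open>psum \<alpha> i + 1, ..., psum \<alpha> (Suc i)\<close>, largest entry first. On the
  diagram the natural subtraction is never truncated, because
  \<open>k < \<alpha> ! i \<le> psum \<alpha> (Suc i)\<close>.\<close>

definition rowwise :: "nat list \<Rightarrow> tableau" where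
  "rowwise \<alpha> = restrict (\<lambda>(i, k). psum \<alpha> (Suc i) - k) (diagram \<alpha>)"

lemma psum_Suc: "i < length \<alpha> \<Longrightarrow> psum \<alpha> (Suc i) = psum \<alpha> i + \<alpha> ! i"
  by (simp add: psum_def take_Suc_conv_app_nth)

lemma psum_mono: "i \<le> j \<Longrightarrow> psum \<alpha> i \<le> psum \<alpha> j"
proof -
  assume "i \<le> j"
  then obtain d where "j = i + d" using le_Suc_ex by blast
  then show ?thesis by (simp add: psum_def take_add)
qed

lemma psum_0: "psum \<alpha> 0 = 0"
  by (simp add: psum_def)

lemma psum_length: "length \<alpha> \<le> i \<Longrightarrow> psum \<alpha> i = sum_list \<alpha>"
  by (simp add: psum_def)

lemma psum_le: "psum \<alpha> i \<le> sum_list \<alpha>"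
  using psum_mono[of i "max i (length \<alpha>)" \<alpha>] psum_length[of \<alpha> "max i (length \<alpha>)"] by simp

lemma rowwise_apply: "(i, k) \<in> diagram \<alpha> \<Longrightarrow> rowwise \<alpha> (i, k) = psum \<alpha> (Suc i) - k"
  by (simp add: rowwise_def)

lemma rowwise_bounds:
  assumes "(i, k) \<in> diagram \<alpha>"
  shows "psum \<alpha> i < rowwise \<alpha> (i, k)" "rowwise \<alpha> (i, k) \<le> psum \<alpha> (Suc i)"
  using assms psum_Suc[of i \<alpha>] by (auto simp: rowwise_apply diagram_def)

text \<open>The blocks of different rows are disjoint and ordered, and within a block entries drop
  with the column. All tableau conditions and the increasing columns are read off from this
  comparison.\<close>

lemma rowwise_less_iff:
  assumes "(i, k) \<in> diagram \<alpha>" "(j, l) \<in> diagram \<alpha>"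
  shows "rowwise \<alpha> (i, k) < rowwise \<alpha> (j, l) \<longleftrightarrow> i < j \<or> i = j \<and> l < k"
proof (cases i j rule: linorder_cases)
  case less
  then show ?thesis
    using rowwise_bounds(2)[OF assms(1)] rowwise_bounds(1)[OF assms(2)] psum_mono[of "Suc i" j \<alpha>] by simp
next
  case equal
  then show ?thesis
    using assms psum_Suc[of i \<alpha>] by (auto simp: rowwise_apply diagram_def)
next
  case greater
  then show ?thesis
    using rowwise_bounds(2)[OF assms(2)] rowwise_bounds(1)[OF assms(1)] psum_mono[of "Suc j" i \<alpha>] by simp
qed

lemma rowwise_fillings: "rowwise \<alpha> \<in> fillings \<alpha>"
proof -
  have "inj_on (rowwise \<alpha>) (diagram \<alpha>)"
  proof (rule inj_onI, clarify)
    fix i k j l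
    assume "(i, k) \<in> diagram \<alpha>" "(j, l) \<in> diagram \<alpha>" "rowwise \<alpha> (i, k) = rowwise \<alpha> (j, l)"
    then show "i = j \<and> k = l"
      using rowwise_less_iff[of i k \<alpha> j l] rowwise_less_iff[of j l \<alpha> i k] by auto
  qed
  moreover have "rowwise \<alpha> ` diagram \<alpha> = {1..sum_list \<alpha>}"
  proof
    show "rowwise \<alpha> ` diagram \<alpha> \<subseteq> {1..sum_list \<alpha>}"
      using rowwise_bounds psum_le[of \<alpha>] by (fastforce dest: order_trans)
    show "{1..sum_list \<alpha>} \<subseteq> rowwise \<alpha> ` diagram \<alpha>"
    proof
      fix x assume x: "x \<in> {1..sum_list \<alpha>}"
      \<comment> \<open>The row whose block contains \<open>x\<close>. It exists because
        \<open>psum\<close> equals the full sum from index \<open>length \<alpha>\<close>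
        on.\<close>
      define i where "i = (LEAST i. x \<le> psum \<alpha> (Suc i))"
      have i: "x \<le> psum \<alpha> (Suc i)"
        unfolding i_def by (rule LeastI[of _ "length \<alpha>"]) (use x in \<open>simp add: psum_length\<close>)
      have low: "psum \<alpha> i < x"
      proof (cases i)
        case 0
        then show ?thesis using x by (simp add: psum_0)
      next
        case (Suc h)
        then have "\<not> x \<le> psum \<alpha> (Suc h)" unfolding i_def by (metis lessI not_less_Least)
        then show ?thesis using Suc by simp
      qed
      have len: "i < length \<alpha>"
      proof (rule ccontr)
        assume "\<not> i < length \<alpha>"
        then show False using low x psum_length[of \<alpha> i] by simp
      qed
      have "(i, psum \<alpha> (Suc i) - x) \<in> diagram \<alpha>"
        using i low len psum_Suc[OF len] by (auto simp: diagram_def)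
      moreover from this have "rowwise \<alpha> (i, psum \<alpha> (Suc i) - x) = x"
        using i by (simp add: rowwise_apply)
      ultimately show "x \<in> rowwise \<alpha> ` diagram \<alpha>" by (metis imageI)
    qed
  qed
  ultimately show ?thesis by (simp add: fillings_def bij_betw_def rowwise_def)
qed

lemma rowwise_SRCT: "rowwise \<alpha> \<in> SRCT \<alpha>"
  unfolding SRCT_iff
proof (intro conjI allI impI)
  show "rowwise \<alpha> \<in> fillings \<alpha>" by (rule rowwise_fillings)
next
  fix i j k
  assume a: "i < j \<and> (i, k) \<in> diagram \<alpha> \<and> (j, k + 1) \<in> diagram \<alpha> \<and> rowwise \<alpha> (j, k + 1) < rowwise \<alpha> (i, k)"
  then have False using rowwise_less_iff[of j "Suc k" \<alpha> i k] by auto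
  then show "(i, k + 1) \<in> diagram \<alpha>" "rowwise \<alpha> (j, k + 1) < rowwise \<alpha> (i, k + 1)" by auto
qed (auto simp: rowwise_less_iff)

lemma rowwise_columns_increasing: "columns_increasing \<alpha> (rowwise \<alpha>)"
  by (auto simp: columns_increasing_def rowwise_less_iff)

section \<open>A tableau with a decreasing pair in a column\<close>

text \<open>If \<open>i < j\<close> violate simplicity, the last cell of row \<open>j\<close> may be filled before row \<open>i\<close>.\<close>

lemma not_simple_columns:
  assumes pos: "\<forall>a\<in>set \<alpha>. 0 < a" and "\<not> simple_composition \<alpha>"
  shows "\<exists>\<tau>\<in>SRCT \<alpha>. \<not> columns_increasing \<alpha> \<tau>"
proof -
  obtain i j where ij: "i < j" "j < length \<alpha>" "\<alpha> ! j \<le> \<alpha> ! i" "2 \<le> \<alpha> ! j"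
    and gap: "\<And>k. i < k \<Longrightarrow> k < j \<Longrightarrow> \<alpha> ! k \<noteq> \<alpha> ! j - 1"
    using assms(2) unfolding simple_composition_def by blast
  let ?rw = "rowwise \<alpha>" and ?c = "\<alpha> ! j - 1"
  \<comment> \<open>\<open>S\<close> is the row-by-row entry of the last cell of row
    \<open>j\<close>, and \<open>s\<close> is the number of cells in the rows above row
    \<open>i\<close>. The permutation \<open>p\<close> moves \<open>S\<close> down to
    \<open>s + 1\<close> and shifts the entries in between up by one.\<close>
  define s S where "s = psum \<alpha> i" and "S = Suc (psum \<alpha> j)"
  define p where "p x = (if x = S then Suc s else if s < x \<and> x < S then Suc x else x)" for x
  define \<tau> where "\<tau> = restrict (p \<circ> ?rw) (diagram \<alpha>)"
  have \<tau>_apply: "\<tau> d = p (?rw d)" if "d \<in> diagram \<alpha>" for d using that by (simp add: \<tau>_def)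
  have sS: "s < S" using psum_mono[of i j \<alpha>] ij(1) by (simp add: s_def S_def)
  have SN: "S \<le> sum_list \<alpha>"
    using psum_le[of \<alpha> "Suc j"] psum_Suc[OF ij(2)] ij(4) by (simp add: S_def)
  have less: "p x < p y \<longleftrightarrow> x < y" if "x \<noteq> S \<or> y \<le> s" "y \<noteq> S \<or> x \<le> s" for x y
    using that sS by (auto simp: p_def)
  have jc: "(j, ?c) \<in> diagram \<alpha>" using ij by (auto simp: diagram_def)
  have S_iff: "?rw d = S \<longleftrightarrow> d = (j, ?c)" if "d \<in> diagram \<alpha>" for d
  proof -
    have "?rw (j, ?c) = S"
      using ij jc psum_Suc[OF ij(2)] by (simp add: rowwise_apply S_def)
    then show ?thesis using entry_inject[OF rowwise_fillings that jc] by simp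
  qed
  have "bij_betw p {1..sum_list \<alpha>} {1..sum_list \<alpha>}"
  proof (rule bij_betw_imageI)
    show inj: "inj_on p {1..sum_list \<alpha>}"
      using sS by (auto simp: inj_on_def p_def split: if_splits)
    show "p ` {1..sum_list \<alpha>} = {1..sum_list \<alpha>}"
      by (rule endo_inj_surj[OF _ _ inj]) (use sS SN in \<open>auto simp: p_def\<close>)
  qed
  then have "bij_betw (p \<circ> ?rw) (diagram \<alpha>) {1..sum_list \<alpha>}"
    using rowwise_fillings by (auto simp: fillings_def intro: bij_betw_trans)
  then have "bij_betw \<tau> (diagram \<alpha>) {1..sum_list \<alpha>}"
    by (subst bij_betw_cong[where g = "p \<circ> ?rw"]) (auto simp: \<tau>_apply)
  then have fill: "\<tau> \<in> fillings \<alpha>" by (simp add: fillings_def \<tau>_def)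
  have "\<tau> \<in> SRCT \<alpha>"
    unfolding SRCT_iff
  proof (intro conjI allI impI)
    show "\<tau> \<in> fillings \<alpha>" by (rule fill)
  next
    fix m k l assume a: "k < l \<and> (m, k) \<in> diagram \<alpha> \<and> (m, l) \<in> diagram \<alpha>"
    then have "?rw (m, l) < ?rw (m, k)" by (simp add: rowwise_less_iff)
    moreover have "?rw (m, k) \<noteq> S" using a S_iff[of "(m, k)"] by (auto simp: diagram_def)
    ultimately show "\<tau> (m, l) < \<tau> (m, k)"
      using a sS by (auto simp: \<tau>_apply p_def)
  next
    fix m m' assume a: "m < m' \<and> (m, 0) \<in> diagram \<alpha> \<and> (m', 0) \<in> diagram \<alpha>"
    then have "?rw (m, 0) < ?rw (m', 0)" by (simp add: rowwise_less_iff)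
    \<comment> \<open>Since \<open>\<alpha> ! j\<close> is at least 2, the entry moved down lies
      outside the first column.\<close>
    moreover have "?rw (m, 0) \<noteq> S" "?rw (m', 0) \<noteq> S"
      using a S_iff[of "(m, 0)"] S_iff[of "(m', 0)"] ij(4) by auto
    ultimately show "\<tau> (m, 0) < \<tau> (m', 0)"
      using a by (simp add: \<tau>_apply less)
  next
    fix m m' k
    assume a: "m < m' \<and> (m, k) \<in> diagram \<alpha> \<and> (m', k + 1) \<in> diagram \<alpha> \<and> \<tau> (m', k + 1) < \<tau> (m, k)"
    have lt: "?rw (m, k) < ?rw (m', Suc k)" using a by (simp add: rowwise_less_iff)
    \<comment> \<open>In the row-by-row filling a lower row never has the smaller entry, so this
      inversion is created by \<open>p\<close>, and the lower cell must be the one that held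
      \<open>S\<close>.\<close>
    have "?rw (m', Suc k) = S" "s < ?rw (m, k)"
      using a lt sS by (auto simp: \<tau>_apply p_def split: if_splits)
    then have m': "m' = j" "Suc k = ?c" using a S_iff[of "(m', Suc k)"] by auto
    have "i \<le> m"
    proof (rule ccontr)
      assume "\<not> i \<le> m"
      then show False
        using rowwise_bounds(2)[of m k \<alpha>] a psum_mono[of "Suc m" i \<alpha>] \<open>s < ?rw (m, k)\<close>
        by (simp add: s_def)
    qed
    \<comment> \<open>Row \<open>m\<close> reaches column \<open>k\<close> but cannot end there: for
      \<open>m\<close> strictly between \<open>i\<close> and \<open>j\<close> by the violation of
      simplicity, for \<open>m = i\<close> because row \<open>i\<close> is at least as long as row
      \<open>j\<close>.\<close>
    then have "\<alpha> ! m \<noteq> Suc k" using gap[of m] a m' ij(3,4) by (cases "i = m") auto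
    then have d: "(m, Suc k) \<in> diagram \<alpha>" using a by (auto simp: diagram_def)
    then show "(m, k + 1) \<in> diagram \<alpha>" by simp
    have "s < ?rw (m, Suc k)"
      using rowwise_bounds(1)[OF d] psum_mono[OF \<open>i \<le> m\<close>, of \<alpha>] by (simp add: s_def)
    moreover have "?rw (m, Suc k) < S"
      using rowwise_less_iff[OF d, of m' "Suc k"] a \<open>?rw (m', Suc k) = S\<close> by simp
    ultimately show "\<tau> (m', k + 1) < \<tau> (m, k + 1)"
      using a d \<open>?rw (m', Suc k) = S\<close> by (simp add: \<tau>_apply p_def)
  qed
  moreover have "\<not> columns_increasing \<alpha> \<tau>"
  proof
    assume inc: "columns_increasing \<alpha> \<tau>"
    have ic: "(i, ?c) \<in> diagram \<alpha>" using ij by (auto simp: diagram_def)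
    have "\<tau> (i, ?c) < \<tau> (j, ?c)" using inc ij(1) ic jc by (auto simp: columns_increasing_def)
    moreover have "s < ?rw (i, ?c)" using rowwise_bounds(1)[OF ic] by (simp add: s_def)
    moreover have "?rw (i, ?c) < ?rw (j, ?c)" using ic jc ij(1) by (simp add: rowwise_less_iff)
    ultimately show False
      using ic jc S_iff[OF jc] by (auto simp: \<tau>_apply p_def split: if_splits)
  qed
  ultimately show ?thesis by blast
qed

section \<open>The source tableau\<close>

text \<open>A cell at which \<open>\<tau>\<close> first departs from the row-by-row filling can be filled later only by
  entering its column from the right, which breaks the triple rule.\<close>

lemma source_eq_rowwise:
  assumes \<tau>: "\<tau> \<in> SRCT \<alpha>" and inc: "columns_increasing \<alpha> \<tau>"
    and source: "\<And>i r c. i \<in> {1..<sum_list \<alpha>} \<Longrightarrow> i \<notin> Des \<alpha> \<tau> \<Longrightarrow>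
      cell_of \<alpha> \<tau> (Suc i) = (r, c) \<Longrightarrow> cell_of \<alpha> \<tau> i = (r, Suc c)"
  shows "\<tau> = rowwise \<alpha>"
proof -
  let ?rw = "rowwise \<alpha>" and ?N = "sum_list \<alpha>"
  let ?cell = "cell_of \<alpha> \<tau>"
  note f = SRCT_fillings[OF \<tau>]
  note cd = cell_of_diagram[OF f] and ec = entry_cell_of[OF f] and ce = cell_of_entry[OF f]
  have "\<tau> d = ?rw d" if "d \<in> diagram \<alpha>" for d
    using that
  proof (induction "?rw d" arbitrary: d rule: less_induct)
    case less
    obtain \<rho> \<gamma> where d: "d = (\<rho>, \<gamma>)" by fastforce
    have X: "(\<rho>, \<gamma>) \<in> diagram \<alpha>" using less.prems d by simp
    define x where "x = ?rw (\<rho>, \<gamma>)"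
    have x: "x \<in> {1..?N}" using entry_range[OF rowwise_fillings X] by (simp add: x_def)
    have filled: "\<tau> e = ?rw e" if "e \<in> diagram \<alpha>" "?rw e < x" for e
      using less.hyps that d by (simp add: x_def)
    have unfilled: "x \<le> ?rw e" if "e \<in> diagram \<alpha>" "x \<le> \<tau> e" for e
      using filled[of e] that by force
    \<comment> \<open>Each value below \<open>x\<close> already sits in its row-by-row cell, so by
      injectivity no other cell can hold it.\<close>
    have early: "?rw e < x" if e: "e \<in> diagram \<alpha>" "\<tau> e < x" for e
    proof -
      have "\<tau> e \<in> {1..?N}" by (rule entry_range[OF f e(1)])
      then have *: "cell_of \<alpha> ?rw (\<tau> e) \<in> diagram \<alpha>" "?rw (cell_of \<alpha> ?rw (\<tau> e)) = \<tau> e"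
        using cell_of_diagram[OF rowwise_fillings] entry_cell_of[OF rowwise_fillings] by auto
      then have "\<tau> (cell_of \<alpha> ?rw (\<tau> e)) = \<tau> e" using filled e(2) by simp
      then show ?thesis using entry_inject[OF f *(1) e(1)] * e(2) by simp
    qed
    show ?case
    proof (rule ccontr)
      assume ne: "\<tau> d \<noteq> ?rw d"
      have "\<not> \<tau> (\<rho>, \<gamma>) < x" using early[OF X] by (auto simp: x_def)
      then have gt: "x < \<tau> (\<rho>, \<gamma>)" using ne d by (simp add: x_def)
      define T where "T = \<tau> (\<rho>, \<gamma>) - 1"
      have T: "\<tau> (\<rho>, \<gamma>) = Suc T" "x \<le> T" "T \<in> {1..<?N}"
        using gt x entry_range[OF f X] by (auto simp: T_def)
      have cellT: "?cell (Suc T) = (\<rho>, \<gamma>)" using ce[OF X] T(1) by simp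
      obtain r' c' where cx: "?cell x = (r', c')" by fastforce
      have D: "(r', c') \<in> diagram \<alpha>" "\<tau> (r', c') = x" using cd[OF x] ec[OF x] cx by auto
      have "x < ?rw (r', c')"
      proof -
        have "(r', c') \<noteq> (\<rho>, \<gamma>)" using D(2) gt by auto
        then have "?rw (r', c') \<noteq> x"
          using entry_inject[OF rowwise_fillings D(1) X] by (simp add: x_def)
        then show ?thesis using unfilled[OF D(1)] D(2) by simp
      qed
      then have after: "\<rho> < r' \<or> \<rho> = r' \<and> c' < \<gamma>"
        using rowwise_less_iff[OF X D(1)] by (auto simp: x_def)
      have r': "\<rho> < r'"
        using after SRCT_row[OF \<tau> _ D(1), of \<gamma>] X D(2) gt by fastforce
      \<comment> \<open>Otherwise increasing columns would give \<open>(\<rho>, c')\<close> an entry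
        below \<open>x\<close>, although the row-by-row filling places that cell no earlier than
        \<open>(\<rho>, \<gamma>)\<close>.\<close>
      have c': "\<gamma> < c'"
      proof (rule ccontr)
        assume "\<not> \<gamma> < c'"
        then have le: "c' \<le> \<gamma>" by simp
        have E: "(\<rho>, c') \<in> diagram \<alpha>" by (rule diagram_left[OF X le])
        have "\<tau> (\<rho>, c') < x" using inc r' E D unfolding columns_increasing_def by blast
        from early[OF E this] show False
          using rowwise_less_iff[OF E X] le by (simp add: x_def)
      qed
      have right: "\<tau> (\<rho>, Suc \<gamma>) < x" if "(\<rho>, Suc \<gamma>) \<in> diagram \<alpha>"
      proof -
        have "?rw (\<rho>, Suc \<gamma>) < x" using rowwise_less_iff[OF that X] by (simp add: x_def)
        then show ?thesis using filled[OF that] by simp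
      qed
      \<comment> \<open>A non-descent \<open>T\<close> would sit immediately to the right of
        \<open>Suc T\<close>, in a cell whose entry is below \<open>x\<close>.\<close>
      have "T \<in> Des \<alpha> \<tau>"
      proof (rule ccontr)
        assume "T \<notin> Des \<alpha> \<tau>"
        from source[OF T(3) this cellT] have "?cell T = (\<rho>, Suc \<gamma>)" .
        moreover have "T \<in> {1..?N}" using T(3) by auto
        ultimately have "(\<rho>, Suc \<gamma>) \<in> diagram \<alpha>" "\<tau> (\<rho>, Suc \<gamma>) = T" using cd ec by metis+
        then show False using right T(2) by simp
      qed
      then have colT: "snd (?cell T) \<le> \<gamma>" using cellT by (simp add: Des_iff)
      \<comment> \<open>The entry \<open>x\<close> lies strictly right of column
        \<open>\<gamma>\<close>, while \<open>T\<close> does not. So \<open>u\<close> is the first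
        entry after \<open>x\<close> that is no longer right of this column; its predecessor
        \<open>w\<close> still is, hence is a non-descent, and the source condition places
        \<open>w\<close> in column \<open>Suc \<gamma>\<close>.\<close>
      define u where "u = (LEAST u. x < u \<and> snd (?cell u) \<le> \<gamma>)"
      have "T \<noteq> x" using colT cx c' by auto
      then have "x < T" using T(2) by simp
      with colT have u: "x < u \<and> snd (?cell u) \<le> \<gamma>" and "u \<le> T"
        unfolding u_def by (auto intro: LeastI2 Least_le)
      define w where "w = u - 1"
      have w: "u = Suc w" "x \<le> w" "w \<in> {1..<?N}" "w < Suc T"
        using u x \<open>u \<le> T\<close> T(3) by (auto simp: w_def)
      have colw: "\<gamma> < snd (?cell w)"
      proof (rule ccontr)
        assume *: "\<not> \<gamma> < snd (?cell w)"
        then have "w \<noteq> x" using cx c' by auto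
        then have "x < w \<and> snd (?cell w) \<le> \<gamma>" using * w(2) by simp
        then have "u \<le> w" unfolding u_def by (rule Least_le)
        then show False using w(1) by simp
      qed
      obtain r c where cu: "?cell (Suc w) = (r, c)" by fastforce
      have cle: "c \<le> \<gamma>" using u w(1) cu by simp
      have "w \<notin> Des \<alpha> \<tau>" using colw cle cu by (auto simp: Des_iff)
      from source[OF w(3) this cu] have cw: "?cell w = (r, Suc c)" .
      then have "c = \<gamma>" using colw cle by simp
      have "w \<in> {1..?N}" using w(3) by auto
      then have W: "(r, Suc \<gamma>) \<in> diagram \<alpha>" "\<tau> (r, Suc \<gamma>) = w"
        using cd[of w] ec[of w] cw \<open>c = \<gamma>\<close> by auto
      have "x \<le> ?rw (r, Suc \<gamma>)" using unfilled[OF W(1)] W(2) w(2) by simp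
      then have "\<not> ?rw (r, Suc \<gamma>) < ?rw (\<rho>, \<gamma>)" by (simp add: x_def)
      then have "\<rho> < r" using rowwise_less_iff[OF W(1) X] by auto
      \<comment> \<open>The cell \<open>(\<rho>, \<gamma>)\<close> holds \<open>Suc T\<close>, which
        exceeds \<open>w\<close>. The triple rule then demands an entry above \<open>w\<close> in
        the right neighbour, whose entry is known to be below \<open>x\<close>.\<close>
      from SRCT_triple[OF \<tau> this X W(1)] W(2) T(1) w(4)
      have "(\<rho>, Suc \<gamma>) \<in> diagram \<alpha>" "w < \<tau> (\<rho>, Suc \<gamma>)" by simp_all
      then show False using right w(2) by simp
    qed
  qed
  then show ?thesis by (rule fillings_eqI[OF f rowwise_fillings])
qed

section \<open>Generating the span from the row-by-row tableau\<close>

definition unit_vec :: "tableau \<Rightarrow> tableau \<Rightarrow> complex" where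
  "unit_vec \<tau> = (\<lambda>\<sigma>. if \<sigma> = \<tau> then 1 else 0)"

lemma pi_linear_unit_vec:
  assumes "\<tau> \<in> SRCT \<alpha>" "pi_op \<alpha> i \<tau> = Some \<rho>"
  shows "pi_linear \<alpha> i (unit_vec \<tau>) = unit_vec \<rho>"
proof
  fix \<sigma>
  have "pi_linear \<alpha> i (unit_vec \<tau>) \<sigma>
      = (\<Sum>\<tau>'\<in>SRCT \<alpha>. if \<tau> = \<tau>' then (if \<rho> = \<sigma> then 1 else 0) else 0)"
    unfolding pi_linear_def unit_vec_def by (rule sum.cong) (auto simp: assms(2))
  then show "pi_linear \<alpha> i (unit_vec \<tau>) \<sigma> = unit_vec \<rho> \<sigma>"
    using assms(1) finite_SRCT by (simp add: sum.delta unit_vec_def)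
qed

text \<open>A termination measure for undoing operators. The weights of \<open>i\<close> and
  \<open>i + 1\<close> differ by one, with the larger at \<open>i\<close>, so moving
  \<open>i\<close> to the left and \<open>i + 1\<close> to the right lowers the sum by the
  difference of their columns.\<close>

definition height :: "nat list \<Rightarrow> tableau \<Rightarrow> nat" where
  "height \<alpha> \<tau> = (\<Sum>x\<in>{1..sum_list \<alpha>}. (sum_list \<alpha> - x) * snd (cell_of \<alpha> \<tau> x))"

lemma height_swap:
  assumes f: "\<tau> \<in> fillings \<alpha>" and i: "i \<in> {1..<sum_list \<alpha>}"
    and lt: "snd (cell_of \<alpha> \<tau> (Suc i)) < snd (cell_of \<alpha> \<tau> i)"
  shows "height \<alpha> (swap_entries \<alpha> i \<tau>) < height \<alpha> \<tau>"
proof -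
  let ?N = "sum_list \<alpha>"
  obtain R where R: "{1..?N} = insert i (insert (Suc i) R)" "i \<notin> R" "Suc i \<notin> R"
  proof
    show "{1..?N} = insert i (insert (Suc i) ({1..?N} - {i, Suc i}))" using i by auto
  qed auto
  have fin: "finite R"
    using finite_atLeastAtMost[of 1 ?N] unfolding R(1) by simp
  have split: "height \<alpha> \<sigma> = (?N - i) * snd (cell_of \<alpha> \<sigma> i) + (?N - Suc i) * snd (cell_of \<alpha> \<sigma> (Suc i))
      + (\<Sum>x\<in>R. (?N - x) * snd (cell_of \<alpha> \<sigma> x))" for \<sigma>
    unfolding height_def R(1) using R(2,3) fin by simp
  have cells: "cell_of \<alpha> (swap_entries \<alpha> i \<tau>) i = cell_of \<alpha> \<tau> (Suc i)"
    "cell_of \<alpha> (swap_entries \<alpha> i \<tau>) (Suc i) = cell_of \<alpha> \<tau> i"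
    using i by (simp_all add: cell_of_swap_entries[OF f i])
  have rest: "(\<Sum>x\<in>R. (?N - x) * snd (cell_of \<alpha> (swap_entries \<alpha> i \<tau>) x))
      = (\<Sum>x\<in>R. (?N - x) * snd (cell_of \<alpha> \<tau> x))"
  proof (rule sum.cong)
    fix x assume "x \<in> R"
    then have "x \<in> {1..?N}" "x \<noteq> i" "x \<noteq> Suc i" using R by auto
    then show "(?N - x) * snd (cell_of \<alpha> (swap_entries \<alpha> i \<tau>) x) = (?N - x) * snd (cell_of \<alpha> \<tau> x)"
      by (simp add: cell_of_swap_entries[OF f i])
  qed simp
  obtain m where m: "?N - i = Suc m" "?N - Suc i = m"
    using i by (cases "?N - i") auto
  show ?thesis
    unfolding split[of \<tau>] split[of "swap_entries \<alpha> i \<tau>"] cells rest m using lt by (simp add: algebra_simps)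
qed

text \<open>By \<open>source_eq_rowwise\<close>, any other tableau has an ascent that can be undone.
  This exhibits it as the image of a tableau with the same column pattern and smaller
  \<open>height\<close>.\<close>

lemma unit_vec_generated:
  assumes A: "invariant_subspace \<alpha> A" and gen: "unit_vec (rowwise \<alpha>) \<in> A"
    and "\<tau> \<in> SRCT \<alpha>" "columns_increasing \<alpha> \<tau>"
  shows "unit_vec \<tau> \<in> A"
  using assms(3,4)
proof (induction "height \<alpha> \<tau>" arbitrary: \<tau> rule: less_induct)
  case less
  note f = SRCT_fillings[OF less.prems(1)]
  show ?case
  proof (cases "\<tau> = rowwise \<alpha>")
    case True
    then show ?thesis using gen by simp
  next
    case False
    then obtain i r' c' where i: "i \<in> {1..<sum_list \<alpha>}" "i \<notin> Des \<alpha> \<tau>"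
      and c': "cell_of \<alpha> \<tau> (Suc i) = (r', c')" and ne: "cell_of \<alpha> \<tau> i \<noteq> (r', Suc c')"
      using source_eq_rowwise[OF less.prems] by blast
    obtain r c where c: "cell_of \<alpha> \<tau> i = (r, c)" by fastforce
    have lt: "c' < c" using i c c' by (auto simp: Des_iff)
    let ?s = "swap_entries \<alpha> i \<tau>"
    have s: "?s \<in> SRCT \<alpha>" "pi_op \<alpha> i ?s = Some \<tau>"
      using pi_op_ascent[OF less.prems(1) i(1) c c' lt] ne c by auto
    have "unit_vec ?s \<in> A"
    proof (rule less.hyps)
      show "height \<alpha> ?s < height \<alpha> \<tau>" by (rule height_swap[OF f i(1)]) (use c c' lt in simp)
      show "columns_increasing \<alpha> ?s" using pi_op_columns_increasing[OF s] less.prems(2) by simp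
    qed (rule s(1))
    then have "pi_linear \<alpha> i (unit_vec ?s) \<in> A" by (rule invariant_pi[OF A i(1)])
    then show ?thesis by (simp only: pi_linear_unit_vec[OF s])
  qed
qed

lemma invariant_full:
  assumes A: "invariant_subspace \<alpha> A" and units: "\<And>\<tau>. \<tau> \<in> SRCT \<alpha> \<Longrightarrow> unit_vec \<tau> \<in> A"
  shows "A = spanned (SRCT \<alpha>)"
proof
  show "A \<subseteq> spanned (SRCT \<alpha>)" by (rule invariant_subset[OF A])
  show "spanned (SRCT \<alpha>) \<subseteq> A"
  proof
    fix v assume v: "v \<in> spanned (SRCT \<alpha>)"
    have comb: "(\<lambda>\<sigma>. \<Sum>\<tau>\<in>S. v \<tau> * unit_vec \<tau> \<sigma>) \<in> A" if "finite S" "S \<subseteq> SRCT \<alpha>" for S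
      using that
    proof (induction S)
      case empty
      then show ?case using invariant_zero[OF A] by simp
    next
      case (insert \<tau> S)
      have "(\<lambda>\<sigma>. v \<tau> * unit_vec \<tau> \<sigma> + (\<Sum>\<tau>\<in>S. v \<tau> * unit_vec \<tau> \<sigma>)) \<in> A"
        by (rule invariant_add[OF A invariant_scale[OF A units]]) (use insert in auto)
      then show ?case using insert by simp
    qed
    have expand: "v = (\<lambda>\<sigma>. \<Sum>\<tau>\<in>SRCT \<alpha>. v \<tau> * unit_vec \<tau> \<sigma>)"
    proof
      fix \<sigma>
      have "(\<Sum>\<tau>\<in>SRCT \<alpha>. v \<tau> * unit_vec \<tau> \<sigma>) = (\<Sum>\<tau>\<in>SRCT \<alpha>. if \<tau> = \<sigma> then v \<tau> else 0)"
        unfolding unit_vec_def by (rule sum.cong) auto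
      then show "v \<sigma> = (\<Sum>\<tau>\<in>SRCT \<alpha>. v \<tau> * unit_vec \<tau> \<sigma>)"
        using sum_restrict_supp[OF finite_SRCT, of \<alpha> v \<sigma>] v by (simp add: spanned_def)
    qed
    show "v \<in> A" by (rule ssubst[OF expand]) (rule comb[OF finite_SRCT subset_refl])
  qed
qed

section \<open>Descent sets\<close>

lemma cell_of_rowwise:
  assumes "m < length \<alpha>" "psum \<alpha> m < x" "x \<le> psum \<alpha> (Suc m)"
  shows "cell_of \<alpha> (rowwise \<alpha>) x = (m, psum \<alpha> (Suc m) - x)"
proof -
  have d: "(m, psum \<alpha> (Suc m) - x) \<in> diagram \<alpha>"
    using assms psum_Suc[OF assms(1)] by (auto simp: diagram_def)
  have "rowwise \<alpha> (m, psum \<alpha> (Suc m) - x) = x" using assms(3) by (simp add: rowwise_apply[OF d])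
  then show ?thesis using cell_of_entry[OF rowwise_fillings d] by simp
qed

text \<open>Each row's block of consecutive entries contains at most one entry of the first column of
  \<open>\<tau>\<close>, so counting from the bottom forces \<open>\<tau> \<le> rowwise \<alpha>\<close> pointwise; the sums of the entries agree.\<close>

lemma Des_subset_rowwise:
  assumes pos: "\<forall>a\<in>set \<alpha>. 0 < a" and \<tau>: "\<tau> \<in> SRCT \<alpha>"
    and sub: "Des \<alpha> \<tau> \<subseteq> Des \<alpha> (rowwise \<alpha>)"
  shows "\<tau> = rowwise \<alpha>"
proof -
  note f = SRCT_fillings[OF \<tau>]
  let ?N = "sum_list \<alpha>"
  \<comment> \<open>The row-by-row tableau has no descent inside a block, so \<tau> has none either,
    and its columns strictly decrease along the block.\<close>
  have step: "snd (cell_of \<alpha> \<tau> (Suc x)) < snd (cell_of \<alpha> \<tau> x)"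
    if "m < length \<alpha>" "psum \<alpha> m < x" "x < psum \<alpha> (Suc m)" for m x
  proof -
    have x: "x \<in> {1..<?N}" using that psum_le[of \<alpha> "Suc m"] by simp
    have "x \<notin> Des \<alpha> (rowwise \<alpha>)"
      using that by (auto simp: Des_iff cell_of_rowwise)
    then have "x \<notin> Des \<alpha> \<tau>" using sub by blast
    then show ?thesis using x by (simp add: Des_iff)
  qed
  have run: "snd (cell_of \<alpha> \<tau> y) < snd (cell_of \<alpha> \<tau> x)"
    if m: "m < length \<alpha>" "psum \<alpha> m < x" "x < y" "y \<le> psum \<alpha> (Suc m)" for m x y
    using that(3,4)
  proof (induction y)
    case (Suc y)
    have y: "snd (cell_of \<alpha> \<tau> (Suc y)) < snd (cell_of \<alpha> \<tau> y)"
      by (rule step[OF m(1)]) (use m(2) Suc.prems in auto)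
    show ?case
    proof (cases "x = y")
      case False
      then have "snd (cell_of \<alpha> \<tau> y) < snd (cell_of \<alpha> \<tau> x)" using Suc by simp
      then show ?thesis using y by simp
    qed (use y in simp)
  qed simp
  have d0: "(m, 0) \<in> diagram \<alpha>" if "m < length \<alpha>" for m
    using pos that by (auto simp: diagram_def)
  have first: "\<tau> (m, 0) \<le> psum \<alpha> (Suc m)" if "m < length \<alpha>" for m
    using that
  proof (induction "length \<alpha> - m" arbitrary: m)
    case 0
    then show ?case by simp
  next
    case (Suc n)
    show ?case
    proof (cases "Suc m < length \<alpha>")
      case False
      then have "psum \<alpha> (Suc m) = ?N" by (simp add: psum_length)
      then show ?thesis using entry_range[OF f d0[OF Suc.prems]] by simp
    next
      case True
      have lt: "\<tau> (m, 0) < \<tau> (Suc m, 0)" by (rule SRCT_first_column[OF \<tau>]) (use d0 True in auto)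
      have le: "\<tau> (Suc m, 0) \<le> psum \<alpha> (Suc (Suc m))" by (rule Suc.hyps(1)) (use Suc.hyps(2) True in auto)
      show ?thesis
      proof (rule ccontr)
        assume "\<not> \<tau> (m, 0) \<le> psum \<alpha> (Suc m)"
        \<comment> \<open>Both first-column entries would fall into the block of row
          \<open>Suc m\<close>, and the later one would have to lie strictly left of column
          0.\<close>
        then have "snd (cell_of \<alpha> \<tau> (\<tau> (Suc m, 0))) < snd (cell_of \<alpha> \<tau> (\<tau> (m, 0)))"
          by (intro run[OF True]) (use lt le in auto)
        then show False by (simp add: cell_of_entry[OF f d0[OF Suc.prems]])
      qed
    qed
  qed
  have le: "\<tau> (m, k) \<le> rowwise \<alpha> (m, k)" if "(m, k) \<in> diagram \<alpha>" for m k
  proof -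
    have "\<tau> (m, k) + k \<le> psum \<alpha> (Suc m)"
      using that
    proof (induction k)
      case 0
      then show ?case using first[of m] by (simp add: diagram_def)
    next
      case (Suc k)
      have d: "(m, k) \<in> diagram \<alpha>" using Suc.prems by (rule diagram_left) simp
      show ?case using Suc.IH[OF d] SRCT_row[OF \<tau> _ d Suc.prems] by simp
    qed
    then show ?thesis by (simp add: rowwise_apply[OF that])
  qed
  have total: "sum \<sigma> (diagram \<alpha>) = \<Sum>{1..?N}" if "\<sigma> \<in> fillings \<alpha>" for \<sigma>
    using that by (intro sum.reindex_bij_betw[where g = "\<lambda>x. x"]) (simp add: fillings_def)
  have fin: "finite (diagram \<alpha>)"
    using f bij_betw_finite[of \<tau> "diagram \<alpha>" "{1..?N}"] by (simp add: fillings_def)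
  have "\<tau> d = rowwise \<alpha> d" if "d \<in> diagram \<alpha>" for d
    by (rule sum_mono_inv[OF _ _ that fin, of \<tau> "rowwise \<alpha>"])
      (use le total[OF f] total[OF rowwise_fillings] in auto)
  then show ?thesis by (rule fillings_eqI[OF f rowwise_fillings])
qed

section \<open>Indecomposability\<close>

text \<open>By idempotence, outputs of \<open>pi_op \<alpha> i\<close> are fixed by it. A tableau
  with descent \<open>i\<close> is sent to zero or to a different tableau, so it is never an
  output.\<close>

lemma pi_linear_Des:
  assumes "\<sigma> \<in> SRCT \<alpha>" "i \<in> Des \<alpha> \<sigma>"
  shows "pi_linear \<alpha> i v \<sigma> = 0"
proof -
  have "pi_op \<alpha> i \<tau> \<noteq> Some \<sigma>" if \<tau>: "\<tau> \<in> SRCT \<alpha>" for \<tau>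
  proof
    assume *: "pi_op \<alpha> i \<tau> = Some \<sigma>"
    have i: "i \<in> {1..<sum_list \<alpha>}" using assms(2) by (simp add: Des_iff)
    from pi_op_idem[OF SRCT_fillings[OF \<tau>] i] have "pi_op \<alpha> i \<sigma> = Some \<sigma>" by (simp add: *)
    moreover have "swap_entries \<alpha> i \<sigma> \<noteq> \<sigma>"
    proof
      assume "swap_entries \<alpha> i \<sigma> = \<sigma>"
      note f = SRCT_fillings[OF assms(1)]
      have "swap_entries \<alpha> i \<sigma> (cell_of \<alpha> \<sigma> i) = Suc i"
        using swap_entries_apply[OF cell_of_diagram[OF f], of i i \<sigma>] entry_cell_of[OF f, of i] i by simp
      moreover have "\<sigma> (cell_of \<alpha> \<sigma> i) = i" using entry_cell_of[OF f, of i] i by simp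
      ultimately show False using \<open>swap_entries \<alpha> i \<sigma> = \<sigma>\<close> by simp
    qed
    ultimately show False using assms(2) by (auto simp: pi_op_def split: if_splits)
  qed
  then show ?thesis by (simp add: pi_linear_def)
qed

text \<open>A fixed vector is an image, so its coefficient vanishes at every tableau with a descent
  outside those of \<open>rowwise \<alpha>\<close>. The tableaux that remain are handled by
  \<open>Des_subset_rowwise\<close>.\<close>

lemma fixed_vector_multiple:
  assumes pos: "\<forall>a\<in>set \<alpha>. 0 < a" and v: "v \<in> spanned (SRCT \<alpha>)"
    and fixed: "\<And>i. i \<in> {1..<sum_list \<alpha>} \<Longrightarrow> i \<notin> Des \<alpha> (rowwise \<alpha>) \<Longrightarrow> pi_linear \<alpha> i v = v"
  shows "v = (\<lambda>\<sigma>. v (rowwise \<alpha>) * unit_vec (rowwise \<alpha>) \<sigma>)"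
proof
  fix \<sigma>
  have "v \<sigma> = 0" if "\<sigma> \<noteq> rowwise \<alpha>"
  proof (cases "\<sigma> \<in> SRCT \<alpha>")
    case False
    then show ?thesis using v by (simp add: spanned_def)
  next
    case True
    then obtain i where i: "i \<in> Des \<alpha> \<sigma>" "i \<notin> Des \<alpha> (rowwise \<alpha>)"
      using Des_subset_rowwise[OF pos True] \<open>\<sigma> \<noteq> rowwise \<alpha>\<close> by blast
    then have "pi_linear \<alpha> i v = v" by (intro fixed) (auto simp: Des_iff)
    then show ?thesis using pi_linear_Des[OF True i(1), of v] by simp
  qed
  then show "v \<sigma> = v (rowwise \<alpha>) * unit_vec (rowwise \<alpha>) \<sigma>" by (simp add: unit_vec_def)
qed

lemma spanned_invariant:
  assumes "\<And>i \<tau> \<sigma>. \<tau> \<in> S \<Longrightarrow> pi_op \<alpha> i \<tau> = Some \<sigma> \<Longrightarrow> \<sigma> \<in> S" "S \<subseteq> SRCT \<alpha>"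
  shows "invariant_subspace \<alpha> (spanned S)"
  unfolding invariant_subspace_def
proof (intro conjI ballI allI)
  show "pi_linear \<alpha> i v \<in> spanned S" if "v \<in> spanned S" for i v
    unfolding pi_linear_eq_push by (rule push_spanned[OF _ that]) (rule assms(1))
qed (use assms(2) in \<open>auto simp: spanned_def\<close>)

lemma spanned_nonzero:
  assumes "\<tau> \<in> S"
  shows "spanned S \<noteq> {\<lambda>_. 0}"
proof
  assume "spanned S = {\<lambda>_. 0}"
  moreover have "unit_vec \<tau> \<in> spanned S" using assms by (auto simp: spanned_def unit_vec_def)
  ultimately have "unit_vec \<tau> = (\<lambda>_. 0)" by blast
  from fun_cong[OF this, of \<tau>] show False by (simp add: unit_vec_def)
qed

lemma decomposable:
  assumes "\<tau> \<in> SRCT \<alpha>" "\<not> columns_increasing \<alpha> \<tau>"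
  shows "\<exists>A B. invariant_subspace \<alpha> A \<and> invariant_subspace \<alpha> B \<and> A \<noteq> {\<lambda>_. 0} \<and> B \<noteq> {\<lambda>_. 0} \<and>
    A \<inter> B = {\<lambda>_. 0} \<and> {\<lambda>\<tau>. u \<tau> + v \<tau> | u v. u \<in> A \<and> v \<in> B} = spanned (SRCT \<alpha>)"
proof -
  define S where "S = {\<tau> \<in> SRCT \<alpha>. columns_increasing \<alpha> \<tau>}"
  define S' where "S' = {\<tau> \<in> SRCT \<alpha>. \<not> columns_increasing \<alpha> \<tau>}"
  have "invariant_subspace \<alpha> (spanned S)" "invariant_subspace \<alpha> (spanned S')"
    by (rule spanned_invariant; auto simp: S_def S'_def pi_op_columns_increasing intro: pi_op_SRCT)+
  moreover have "spanned S \<noteq> {\<lambda>_. 0}"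
    by (rule spanned_nonzero[of "rowwise \<alpha>"]) (simp add: S_def rowwise_SRCT rowwise_columns_increasing)
  moreover have "spanned S' \<noteq> {\<lambda>_. 0}"
    by (rule spanned_nonzero[of \<tau>]) (use assms in \<open>simp add: S'_def\<close>)
  moreover have "spanned S \<inter> spanned S' = {\<lambda>_. 0}"
  proof
    show "spanned S \<inter> spanned S' \<subseteq> {\<lambda>_. 0}"
    proof
      fix v assume "v \<in> spanned S \<inter> spanned S'"
      then have "v \<sigma> = 0" for \<sigma> by (cases "\<sigma> \<in> S") (auto simp: spanned_def S_def S'_def)
      then show "v \<in> {\<lambda>_. 0}" by auto
    qed
  qed (auto simp: spanned_def)
  moreover have "{\<lambda>\<tau>. u \<tau> + v \<tau> | u v. u \<in> spanned S \<and> v \<in> spanned S'} = spanned (SRCT \<alpha>)"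
  proof
    show "{\<lambda>\<tau>. u \<tau> + v \<tau> | u v. u \<in> spanned S \<and> v \<in> spanned S'} \<subseteq> spanned (SRCT \<alpha>)"
      by (auto simp: spanned_def S_def S'_def)
    show "spanned (SRCT \<alpha>) \<subseteq> {\<lambda>\<tau>. u \<tau> + v \<tau> | u v. u \<in> spanned S \<and> v \<in> spanned S'}"
    proof
      fix v assume v: "v \<in> spanned (SRCT \<alpha>)"
      let ?u = "\<lambda>\<tau>. if \<tau> \<in> S then v \<tau> else 0" and ?w = "\<lambda>\<tau>. if \<tau> \<in> S' then v \<tau> else 0"
      have "v = (\<lambda>\<tau>. ?u \<tau> + ?w \<tau>)"
        using v by (auto simp: spanned_def S_def S'_def)
      moreover have "?u \<in> spanned S" "?w \<in> spanned S'" by (auto simp: spanned_def)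
      ultimately show "v \<in> {\<lambda>\<tau>. u \<tau> + v \<tau> | u v. u \<in> spanned S \<and> v \<in> spanned S'}"
        by (intro CollectI exI[of _ ?u] exI[of _ ?w] conjI)
    qed
  qed
  ultimately show ?thesis by blast
qed

lemma not_decomposable:
  assumes pos: "\<forall>a\<in>set \<alpha>. 0 < a" and inc: "\<And>\<tau>. \<tau> \<in> SRCT \<alpha> \<Longrightarrow> columns_increasing \<alpha> \<tau>"
    and A: "invariant_subspace \<alpha> A" and B: "invariant_subspace \<alpha> B"
    and disj: "A \<inter> B = {\<lambda>_. 0}"
    and sum: "{\<lambda>\<tau>. u \<tau> + v \<tau> | u v. u \<in> A \<and> v \<in> B} = spanned (SRCT \<alpha>)"
  shows "A = {\<lambda>_. 0} \<or> B = {\<lambda>_. 0}"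
proof -
  let ?e = "unit_vec (rowwise \<alpha>)"
  have "?e \<in> {\<lambda>\<tau>. u \<tau> + v \<tau> | u v. u \<in> A \<and> v \<in> B}"
    unfolding sum using rowwise_SRCT by (auto simp: unit_vec_def spanned_def)
  then obtain a b where a: "a \<in> A" and b: "b \<in> B" and e: "?e = (\<lambda>\<tau>. a \<tau> + b \<tau>)"
    by blast
  have as: "a \<in> spanned (SRCT \<alpha>)" using a invariant_subset[OF A] by blast
  have "pi_linear \<alpha> i a = a"
    if i: "i \<in> {1..<sum_list \<alpha>}" "i \<notin> Des \<alpha> (rowwise \<alpha>)" for i
  proof -
    have "pi_linear \<alpha> i ?e = ?e"
      by (rule pi_linear_unit_vec[OF rowwise_SRCT]) (simp add: pi_op_def i(2))
    moreover have "pi_linear \<alpha> i ?e = (\<lambda>\<tau>. pi_linear \<alpha> i a \<tau> + pi_linear \<alpha> i b \<tau>)"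
      unfolding e by (auto simp: pi_linear_def sum.distrib[symmetric] intro!: sum.cong)
    ultimately have eq: "pi_linear \<alpha> i a \<tau> + pi_linear \<alpha> i b \<tau> = a \<tau> + b \<tau>" for \<tau>
      using e by (metis (no_types, lifting))
    \<comment> \<open>Two expressions for the same vector, one visibly in \<open>A\<close> and the
      other in \<open>B\<close>.\<close>
    let ?d = "\<lambda>\<tau>. pi_linear \<alpha> i a \<tau> + (-1) * a \<tau>"
    have "?d \<in> A"
      by (rule invariant_add[OF A invariant_pi[OF A i(1) a] invariant_scale[OF A a]])
    moreover have "?d = (\<lambda>\<tau>. b \<tau> + (-1) * pi_linear \<alpha> i b \<tau>)"
      using eq by (auto simp: algebra_simps)
    moreover have "(\<lambda>\<tau>. b \<tau> + (-1) * pi_linear \<alpha> i b \<tau>) \<in> B"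
      by (rule invariant_add[OF B b invariant_scale[OF B invariant_pi[OF B i(1) b]]])
    ultimately have "?d = (\<lambda>_. 0)" using disj by (metis (no_types, lifting) IntI singletonD)
    from fun_cong[OF this] have "pi_linear \<alpha> i a \<tau> = a \<tau>" for \<tau> by simp
    then show ?thesis by auto
  qed
  from fixed_vector_multiple[OF pos as this] have am: "a = (\<lambda>\<sigma>. a (rowwise \<alpha>) * ?e \<sigma>)" .
  have full: "X = spanned (SRCT \<alpha>)" if "invariant_subspace \<alpha> X" "?e \<in> X" for X
    using unit_vec_generated[OF that] inc by (intro invariant_full[OF that(1)]) auto
  show ?thesis
  \<comment> \<open>If the coefficient is zero, then \<open>?e = b\<close> lies in \<open>B\<close>;
    otherwise dividing \<open>a\<close> by it shows that \<open>?e\<close> lies in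
    \<open>A\<close>.\<close>
  proof (cases "a (rowwise \<alpha>) = 0")
    case True
    then have "a = (\<lambda>_. 0)" using am by simp
    then have "?e = b" using e by simp
    then have "B = spanned (SRCT \<alpha>)" using full[OF B] b by simp
    then show ?thesis using disj invariant_subset[OF A] by blast
  next
    case False
    have "(\<lambda>\<tau>. inverse (a (rowwise \<alpha>)) * a \<tau>) \<in> A" by (rule invariant_scale[OF A a])
    moreover have "(\<lambda>\<tau>. inverse (a (rowwise \<alpha>)) * a \<tau>) = ?e"
    proof
      fix \<tau>
      show "inverse (a (rowwise \<alpha>)) * a \<tau> = ?e \<tau>"
        using fun_cong[OF am, of \<tau>] False by (simp add: field_simps)
    qed
    ultimately have "A = spanned (SRCT \<alpha>)" using full[OF A] by simp
    then show ?thesis using disj invariant_subset[OF B] by blast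
  qed
qed

theorem theorem7p8:
  fixes \<alpha> :: "nat list" and n :: nat
  assumes "composition_of \<alpha> n"
  shows "indecomposable_module (hecke0 n) (SRCT_module \<alpha>) \<longleftrightarrow> simple_composition \<alpha>"
proof -
  have pos: "\<forall>a\<in>set \<alpha>. 0 < a" and n: "n = sum_list \<alpha>" using assms by (auto simp: composition_of_def)
  have "SRCT \<alpha> \<noteq> {}" using rowwise_SRCT by blast
  show ?thesis
  proof
    assume "indecomposable_module (hecke0 n) (SRCT_module \<alpha>)"
    then show "simple_composition \<alpha>"
      unfolding n indecomposable_iff using not_simple_columns[OF pos] decomposable[of _ \<alpha>] by blast
  next
    assume "simple_composition \<alpha>"
    then have inc: "\<And>\<tau>. \<tau> \<in> SRCT \<alpha> \<Longrightarrow> columns_increasing \<alpha> \<tau>"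
      by (rule simple_columns_increasing)
    show "indecomposable_module (hecke0 n) (SRCT_module \<alpha>)"
      unfolding n indecomposable_iff
      using \<open>SRCT \<alpha> \<noteq> {}\<close> not_decomposable[OF pos inc] by blast
  qed
qed

end
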